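(* For every constant $\varepsilon>0$ there are constants $\gamma(\varepsilon),\gamma'(\varepsilon),\gamma''(\varepsilon)>0$ depending only on $\varepsilon$ such that for every fixed integer $d\ge3$: if $G$ is a uniformly random $d$-regular graph on $n$ vertices with adjacency matrix $A_G$, then with probability $1-o_n(1)$ there is a degree-2 Boolean pseudoexpectation $\tilde{\mathbb{E}}$ with $\tilde{\mathbb{E}}[x^{\top}(-A_G)x]\ge(1-2\varepsilon-o_n(1))\,2\sqrt{d-1}\,n$ whose pseudomoment matrix $\mathcal{M}$ satisfies: (1) every row of $\mathcal{M}$ has $\ell_2$ norm at most $\gamma(\varepsilon)$; (2) $\|\mathcal{M}\|_2\le\gamma'(\varepsilon)$; (3) every off-diagonal entry of $\mathcal{M}$ has magnitude at most $\gamma''(\varepsilon)/\sqrt d$.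
   Context: A degree-2 Boolean pseudoexpectation on variables $x=(x_v)_{v\in V}$ is a linear functional $\tilde{\mathbb{E}}$ on multilinear polynomials of degree at most 2 with $\tilde{\mathbb{E}}[1]=1$, $\tilde{\mathbb{E}}[x_v^2]=1$, and $\tilde{\mathbb{E}}[p^2]\ge0$ for every polynomial $p$ of degree at most 1 (squares reduced using $x_v^2=1$). Its pseudomoment matrix $\mathcal{M}$ is indexed by subsets of $V$ of size at most 1, with $\mathcal{M}[S,T]=\tilde{\mathbb{E}}[\prod_{v\in S\Delta T}x_v]$; it is positive semidefinite. $n$ ranges over values with $dn$ even. *)

theory Defs
  imports "HOL-Probability.Probability"
begin

text \<open>A multilinear polynomial is encoded by its coefficients: \<open>p S\<close> is the coefficient of
  the monomial \<open>\<Prod>v\<in>S. x\<^sub>v\<close>.\<close>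

type_synonym 'v mlpoly = "'v set \<Rightarrow> real"

definition mlpolys :: "'v set \<Rightarrow> nat \<Rightarrow> 'v mlpoly set" where
  "mlpolys V k = {p. \<forall>S. p S \<noteq> 0 \<longrightarrow> S \<subseteq> V \<and> card S \<le> k}"

definition mlmonom :: "'v set \<Rightarrow> 'v mlpoly" where
  "mlmonom S = (\<lambda>T. if T = S then 1 else 0)"

text \<open>Multiplication modulo \<open>x\<^sub>v\<^sup>2 = 1\<close>, under which the product of the monomials of \<open>S\<close>
  and \<open>T\<close> is the monomial of their symmetric difference.\<close>

definition mlmult :: "'v set \<Rightarrow> 'v mlpoly \<Rightarrow> 'v mlpoly \<Rightarrow> 'v mlpoly" where
  "mlmult V p q = (\<lambda>U. \<Sum>S\<in>Pow V. \<Sum>T\<in>Pow V. if sym_diff S T = U then p S * q T else 0)"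

text \<open>The functional is only constrained on polynomials of degree at most 2; its values
  elsewhere are irrelevant.\<close>

definition pseudoexpectation2 :: "'v set \<Rightarrow> ('v mlpoly \<Rightarrow> real) \<Rightarrow> bool" where
  "pseudoexpectation2 V E \<longleftrightarrow>
     (\<forall>p\<in>mlpolys V 2. \<forall>q\<in>mlpolys V 2. E (\<lambda>S. p S + q S) = E p + E q) \<and>
     (\<forall>c. \<forall>p\<in>mlpolys V 2. E (\<lambda>S. c * p S) = c * E p) \<and>
     E (mlmonom {}) = 1 \<and>
     (\<forall>v\<in>V. E (mlmult V (mlmonom {v}) (mlmonom {v})) = 1) \<and>
     (\<forall>p\<in>mlpolys V 1. E (mlmult V p p) \<ge> 0)"

definition small_subsets :: "'v set \<Rightarrow> 'v set set" where
  "small_subsets V = {S. S \<subseteq> V \<and> card S \<le> 1}"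

definition pseudomoment_matrix :: "('v mlpoly \<Rightarrow> real) \<Rightarrow> 'v set \<Rightarrow> 'v set \<Rightarrow> real" where
  "pseudomoment_matrix E S T = E (mlmonom (sym_diff S T))"

definition quad_poly :: "'v set \<Rightarrow> ('v \<Rightarrow> 'v \<Rightarrow> real) \<Rightarrow> 'v mlpoly" where
  "quad_poly V B = (\<lambda>U. \<Sum>u\<in>V. \<Sum>v\<in>V. B u v * mlmult V (mlmonom {u}) (mlmonom {v}) U)"

definition spectral_norm :: "'i set \<Rightarrow> ('i \<Rightarrow> 'i \<Rightarrow> real) \<Rightarrow> real" where
  "spectral_norm I M = (SUP f\<in>{f. L2_set f I \<le> 1}. L2_set (\<lambda>i. \<Sum>j\<in>I. M i j * f j) I)"

text \<open>A simple graph on the vertex set \<open>{..<n}\<close> is identified with its set of edges.\<close>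

definition regular_graphs :: "nat \<Rightarrow> nat \<Rightarrow> nat set set set" where
  "regular_graphs n d =
     {G. G \<subseteq> {e. e \<subseteq> {..<n} \<and> card e = 2} \<and> (\<forall>v<n. card {e\<in>G. v \<in> e} = d)}"

definition adj_matrix :: "'v set set \<Rightarrow> 'v \<Rightarrow> 'v \<Rightarrow> real" where
  "adj_matrix G u v = (if {u, v} \<in> G then 1 else 0)"

end

theory Submission
  imports Defs "HOL-Computational_Algebra.Polynomial"
begin

text \<open>
  Let \<open>q\<close> be a bump function with values in \<open>[0, 1]\<close> supported on \<open>x \<le> - (1 - \<epsilon>) 2 \<surd>(d - 1)\<close>. The
  matrix \<open>q(A)\<close> is positive semidefinite of norm at most \<open>1\<close>, and \<open>tr (- A q(A))\<close> is at least
  \<open>(1 - \<epsilon>) 2 \<surd>(d - 1) tr q(A)\<close>. All but \<open>O(1)\<close> vertices (in expectation) of a random \<open>d\<close>-regular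
  graph have no short cycle nearby, and at such a vertex the diagonal entry of \<open>q(A)\<close> is
  approximately the integral of \<open>q\<close> against the Kesten-McKay measure of the \<open>d\<close>-regular tree, which
  is bounded below independently of \<open>d\<close>. Dividing by this integral and replacing the rows and
  columns of the exceptional vertices by those of the identity gives the pseudomoment matrix.

  To avoid spectral theory, \<open>q\<close> is replaced by a Bernstein polynomial \<open>p\<close> on \<open>[-d, d]\<close>: then \<open>p\<close> and
  \<open>1 - p\<close> are nonnegative combinations of the products \<open>(x + d)\<^sup>i (d - x)\<^sup>j\<close>, which are positive
  semidefinite at \<open>A\<close> because \<open>A + d\<close> and \<open>d - A\<close> are. With a polynomial the local computations
  are exact: they are carried out in the basis of the nonbacktracking polynomials, which are
  orthogonal for the Kesten-McKay measure. The exceptional vertices are counted by switching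
  edges, directly in the uniform model.
\<close>

section \<open>Polynomials of symmetric matrices\<close>

definition matvec :: "'i set \<Rightarrow> ('i \<Rightarrow> 'i \<Rightarrow> real) \<Rightarrow> ('i \<Rightarrow> real) \<Rightarrow> 'i \<Rightarrow> real" where
  "matvec I M f u = (\<Sum>v\<in>I. M u v * f v)"

definition inner_on :: "'i set \<Rightarrow> ('i \<Rightarrow> real) \<Rightarrow> ('i \<Rightarrow> real) \<Rightarrow> real" where
  "inner_on I f g = (\<Sum>u\<in>I. f u * g u)"

definition psd_on :: "'i set \<Rightarrow> ('i \<Rightarrow> 'i \<Rightarrow> real) \<Rightarrow> bool" where
  "psd_on I M \<longleftrightarrow> (\<forall>f. 0 \<le> inner_on I f (matvec I M f))"

definition l2_bounded :: "'i set \<Rightarrow> ('i \<Rightarrow> 'i \<Rightarrow> real) \<Rightarrow> real \<Rightarrow> bool" where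
  "l2_bounded I M g \<longleftrightarrow> (\<forall>f. L2_set (matvec I M f) I \<le> g * L2_set f I)"

definition poly_op :: "'i set \<Rightarrow> ('i \<Rightarrow> 'i \<Rightarrow> real) \<Rightarrow> real poly \<Rightarrow> ('i \<Rightarrow> real) \<Rightarrow> 'i \<Rightarrow> real" where
  "poly_op I A p f u = (\<Sum>i\<le>degree p. coeff p i * (matvec I A ^^ i) f u)"

definition poly_mat :: "'i set \<Rightarrow> ('i \<Rightarrow> 'i \<Rightarrow> real) \<Rightarrow> real poly \<Rightarrow> 'i \<Rightarrow> 'i \<Rightarrow> real" where
  "poly_mat I A p u v = poly_op I A p (\<lambda>w. of_bool (w = v)) u"

lemma inner_on_add_right: "inner_on I f (\<lambda>u. g u + h u) = inner_on I f g + inner_on I f h"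
  by (simp add: inner_on_def distrib_left sum.distrib)

lemma inner_on_diff_right: "inner_on I f (\<lambda>u. g u - h u) = inner_on I f g - inner_on I f h"
  by (simp add: inner_on_def right_diff_distrib sum_subtractf)

lemma inner_on_cmult_right: "inner_on I f (\<lambda>u. c * g u) = c * inner_on I f g"
  by (simp add: inner_on_def sum_distrib_left mult_ac)

lemma inner_on_commute: "inner_on I f g = inner_on I g f"
  by (simp add: inner_on_def mult.commute)

lemma inner_on_cong:
  assumes "\<And>u. u \<in> I \<Longrightarrow> f u = f' u" "\<And>u. u \<in> I \<Longrightarrow> g u = g' u"
  shows "inner_on I f g = inner_on I f' g'"
  using assms by (simp add: inner_on_def)

lemma inner_on_self_nonneg: "0 \<le> inner_on I f f"
  by (simp add: inner_on_def sum_nonneg)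

lemma inner_on_of_bool:
  assumes "finite I" "u \<in> I"
  shows "inner_on I (\<lambda>w. of_bool (w = u)) f = f u"
  using assms by (simp add: inner_on_def sum_of_bool_mult_eq)

lemma L2_set_power2: "(L2_set f I)\<^sup>2 = inner_on I f f"
  by (simp add: L2_set_def inner_on_def sum_nonneg power2_eq_square)

lemma l2_bounded_iff:
  assumes "0 \<le> g"
  shows "l2_bounded I M g \<longleftrightarrow>
    (\<forall>f. inner_on I (matvec I M f) (matvec I M f) \<le> g\<^sup>2 * inner_on I f f)"
proof -
  have "L2_set (matvec I M f) I \<le> g * L2_set f I \<longleftrightarrow>
      (L2_set (matvec I M f) I)\<^sup>2 \<le> (g * L2_set f I)\<^sup>2" for f
    using assms by (intro power_mono_iff[symmetric]) auto
  then show ?thesis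
    by (simp add: l2_bounded_def power_mult_distrib L2_set_power2)
qed

lemma l2_bounded_imp_spectral_norm_le:
  assumes "l2_bounded I M g" "0 \<le> g"
  shows "spectral_norm I M \<le> g"
  unfolding spectral_norm_def
proof (rule cSUP_least)
  show "{f. L2_set f I \<le> 1} \<noteq> {}"
    by (auto intro!: exI[of _ "\<lambda>_. 0"] simp: L2_set_def)
  fix f assume "f \<in> {f. L2_set f I \<le> 1}"
  then have "g * L2_set f I \<le> g"
    using assms(2) by (intro mult_left_le) auto
  moreover have "L2_set (matvec I M f) I \<le> g * L2_set f I"
    using assms(1) by (simp add: l2_bounded_def)
  ultimately show "L2_set (\<lambda>i. \<Sum>j\<in>I. M i j * f j) I \<le> g"
    by (simp add: matvec_def[abs_def])
qed

lemma poly_op_eq_sum_atMost: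
  assumes "degree p \<le> N"
  shows "poly_op I A p f u = (\<Sum>i\<le>N. coeff p i * (matvec I A ^^ i) f u)"
  unfolding poly_op_def using assms
  by (intro sum.mono_neutral_left) (auto simp: coeff_eq_0)

lemma poly_op_0 [simp]: "poly_op I A 0 f = (\<lambda>u. 0)"
  by (simp add: fun_eq_iff poly_op_def)

lemma poly_op_1 [simp]: "poly_op I A 1 f = f"
  by (simp add: poly_op_def fun_eq_iff)

lemma poly_op_add [simp]: "poly_op I A (p + q) f = (\<lambda>u. poly_op I A p f u + poly_op I A q f u)"
proof
  fix u
  let ?N = "max (degree p) (degree q)"
  show "poly_op I A (p + q) f u = poly_op I A p f u + poly_op I A q f u"
    by (simp add: poly_op_eq_sum_atMost[of p ?N] poly_op_eq_sum_atMost[of q ?N]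
        poly_op_eq_sum_atMost[of "p + q" ?N] degree_add_le_max distrib_right sum.distrib)
qed

lemma poly_op_smult [simp]: "poly_op I A (smult c p) f = (\<lambda>u. c * poly_op I A p f u)"
  by (simp add: fun_eq_iff poly_op_eq_sum_atMost[of "smult c p" "degree p"] poly_op_def
      sum_distrib_left mult.assoc)

lemma poly_op_diff [simp]: "poly_op I A (p - q) f = (\<lambda>u. poly_op I A p f u - poly_op I A q f u)"
  using poly_op_add[of I A "p - q" q f] by (simp add: fun_eq_iff)

lemma poly_op_sum: "poly_op I A (\<Sum>i\<in>S. p i) f u = (\<Sum>i\<in>S. poly_op I A (p i) f u)"
  by (induction S rule: infinite_finite_induct) auto

lemma poly_op_pCons: "poly_op I A (pCons a p) f = (\<lambda>u. a * f u + matvec I A (poly_op I A p f) u)"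
proof
  fix u
  have "poly_op I A (pCons a p) f u =
      (\<Sum>i\<le>Suc (degree p). coeff (pCons a p) i * (matvec I A ^^ i) f u)"
    by (intro poly_op_eq_sum_atMost) (simp add: degree_pCons_le)
  also have "\<dots> = a * f u + (\<Sum>i\<le>degree p. coeff p i * (\<Sum>w\<in>I. A u w * (matvec I A ^^ i) f w))"
    by (simp add: sum.atMost_Suc_shift matvec_def del: sum.atMost_Suc)
  also have "(\<Sum>i\<le>degree p. coeff p i * (\<Sum>w\<in>I. A u w * (matvec I A ^^ i) f w)) =
      matvec I A (poly_op I A p f) u"
    unfolding matvec_def[of I A "poly_op I A p f"] poly_op_def sum_distrib_left
    by (subst sum.swap) (simp add: mult_ac)
  finally show "poly_op I A (pCons a p) f u = a * f u + matvec I A (poly_op I A p f) u" .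
qed

lemma poly_op_linear: "poly_op I A [:c, e:] f = (\<lambda>u. c * f u + e * matvec I A f u)"
  by (simp add: poly_op_pCons fun_eq_iff matvec_def sum_distrib_left mult_ac)

lemma poly_op_const [simp]: "poly_op I A [:c:] f = (\<lambda>u. c * f u)"
  by (simp add: poly_op_pCons matvec_def)

lemma poly_op_mult: "poly_op I A (p * q) f = poly_op I A p (poly_op I A q f)"
proof (induction p)
  case (pCons a p)
  then show ?case by (simp add: poly_op_pCons)
qed simp

lemma matvec_poly_mat:
  assumes "finite I" "u \<in> I"
  shows "matvec I (poly_mat I A p) f u = poly_op I A p f u"
  using assms(2)
proof (induction p arbitrary: u)
  case 0
  then show ?case by (simp add: matvec_def poly_mat_def)
next
  case (pCons a p)
  have "matvec I (poly_mat I A (pCons a p)) f u =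
      (\<Sum>v\<in>I. a * of_bool (u = v) * f v) + (\<Sum>v\<in>I. \<Sum>w\<in>I. A u w * poly_mat I A p w v * f v)"
    by (simp add: poly_op_pCons matvec_def poly_mat_def distrib_right sum.distrib sum_distrib_right)
  also have "(\<Sum>v\<in>I. \<Sum>w\<in>I. A u w * poly_mat I A p w v * f v) =
      (\<Sum>w\<in>I. A u w * matvec I (poly_mat I A p) f w)"
    by (subst sum.swap) (simp add: matvec_def sum_distrib_left mult.assoc)
  also have "\<dots> = matvec I A (poly_op I A p f) u"
    unfolding matvec_def[of I A] by (intro sum.cong refl) (simp add: pCons.IH)
  also have "(\<Sum>v\<in>I. a * of_bool (u = v) * f v) = a * f u"
    using assms(1) pCons.prems by (simp add: mult.assoc sum_of_bool_mult_eq flip: sum_distrib_left)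
  finally show ?case by (simp add: poly_op_pCons)
qed

lemma poly_mat_X:
  assumes "finite I" "v \<in> I"
  shows "poly_mat I A [:0, 1:] u v = A u v"
  using assms by (simp add: poly_mat_def poly_op_linear matvec_def sum_mult_of_bool_eq)

locale symmetric_matrix =
  fixes I :: "'i set" and A :: "'i \<Rightarrow> 'i \<Rightarrow> real"
  assumes finite_index: "finite I"
    and sym: "u \<in> I \<Longrightarrow> v \<in> I \<Longrightarrow> A u v = A v u"
begin

lemma matvec_self_adjoint: "inner_on I f (matvec I A g) = inner_on I (matvec I A f) g"
proof -
  have "inner_on I f (matvec I A g) = (\<Sum>v\<in>I. \<Sum>u\<in>I. A u v * f u * g v)"
    unfolding inner_on_def matvec_def sum_distrib_left by (subst sum.swap) (simp add: mult_ac)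
  also have "\<dots> = (\<Sum>v\<in>I. \<Sum>u\<in>I. A v u * f u * g v)"
    by (intro sum.cong refl) (simp add: sym)
  finally show ?thesis
    by (simp add: inner_on_def matvec_def sum_distrib_right)
qed

lemma poly_op_self_adjoint: "inner_on I f (poly_op I A p g) = inner_on I (poly_op I A p f) g"
proof (induction p arbitrary: f)
  case 0
  then show ?case by (simp add: inner_on_def)
next
  case (pCons a p)
  have commute: "poly_op I A p (matvec I A f) = matvec I A (poly_op I A p f)"
    using poly_op_mult[of I A p "[:0, 1:]" f] poly_op_mult[of I A "[:0, 1:]" p f]
    by (simp add: poly_op_linear mult.commute[of p] del: mult_pCons_left mult_pCons_right)
  have "inner_on I f (poly_op I A (pCons a p) g) =
      a * inner_on I f g + inner_on I f (matvec I A (poly_op I A p g))"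
    by (simp add: poly_op_pCons inner_on_add_right inner_on_cmult_right)
  also have "inner_on I f (matvec I A (poly_op I A p g)) =
      inner_on I (matvec I A (poly_op I A p f)) g"
    by (simp add: matvec_self_adjoint pCons.IH commute)
  finally show ?case
    by (simp add: poly_op_pCons inner_on_add_right inner_on_cmult_right inner_on_commute[of _ _ g])
qed

lemma l2_bounded_imp_row_le:
  assumes "l2_bounded I A g" "u \<in> I"
  shows "L2_set (A u) I \<le> g"
proof -
  let ?e = "\<lambda>w. of_bool (w = u) :: real"
  have "L2_set (A u) I = L2_set (matvec I A ?e) I"
    using assms(2) finite_index
    by (intro L2_set_cong) (simp_all add: matvec_def sym[of u] sum_mult_of_bool_eq)
  also have "\<dots> \<le> g * L2_set ?e I"
    using assms(1) by (simp add: l2_bounded_def)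
  also have "L2_set ?e I = 1"
    using assms(2) finite_index inner_on_of_bool[of I u ?e]
    by (simp add: L2_set_def inner_on_def power2_eq_square)
  finally show ?thesis by simp
qed

lemma poly_mat_eq_inner:
  assumes "u \<in> I"
  shows "poly_mat I A p u v =
    inner_on I (\<lambda>w. of_bool (w = u)) (poly_op I A p (\<lambda>w. of_bool (w = v)))"
  using assms by (simp add: poly_mat_def inner_on_of_bool finite_index)

lemma poly_mat_sym:
  assumes "u \<in> I" "v \<in> I"
  shows "poly_mat I A p u v = poly_mat I A p v u"
  unfolding poly_mat_eq_inner[OF assms(1)] poly_mat_eq_inner[OF assms(2)]
  by (subst poly_op_self_adjoint) (rule inner_on_commute)

lemma symmetric_matrix_poly_mat: "symmetric_matrix I (poly_mat I A p)"
  by unfold_locales (simp_all add: finite_index poly_mat_sym)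

lemma poly_mat_mult_diag:
  assumes "u \<in> I"
  shows "poly_mat I A (p * q) u u = (\<Sum>w\<in>I. poly_mat I A p u w * poly_mat I A q u w)"
proof -
  let ?e = "\<lambda>w. of_bool (w = u)"
  have "poly_mat I A (p * q) u u = inner_on I (poly_op I A p ?e) (poly_op I A q ?e)"
    unfolding poly_mat_eq_inner[OF assms] poly_op_mult by (rule poly_op_self_adjoint)
  also have "\<dots> = (\<Sum>w\<in>I. poly_mat I A p w u * poly_mat I A q w u)"
    by (simp add: inner_on_def poly_mat_def)
  also have "\<dots> = (\<Sum>w\<in>I. poly_mat I A p u w * poly_mat I A q u w)"
    by (intro sum.cong refl arg_cong2[where f = times] poly_mat_sym assms)
  finally show ?thesis .
qed

definition psd_poly :: "real poly \<Rightarrow> bool" where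
  "psd_poly p \<longleftrightarrow> (\<forall>f. 0 \<le> inner_on I f (poly_op I A p f))"

lemma psd_poly_1: "psd_poly 1"
  by (simp add: psd_poly_def inner_on_self_nonneg)

lemma psd_poly_add: "psd_poly p \<Longrightarrow> psd_poly q \<Longrightarrow> psd_poly (p + q)"
  by (simp add: psd_poly_def inner_on_add_right)

lemma psd_poly_smult: "0 \<le> c \<Longrightarrow> psd_poly p \<Longrightarrow> psd_poly (smult c p)"
  by (simp add: psd_poly_def inner_on_cmult_right)

lemma psd_poly_conj:
  assumes "psd_poly p"
  shows "psd_poly (q * p * q)"
proof -
  have "inner_on I f (poly_op I A (q * p * q) f) =
      inner_on I (poly_op I A q f) (poly_op I A p (poly_op I A q f))" for f
    by (simp only: poly_op_mult poly_op_self_adjoint)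
  with assms show ?thesis by (simp add: psd_poly_def)
qed

lemma psd_on_poly_mat:
  assumes "psd_poly p"
  shows "psd_on I (poly_mat I A p)"
proof -
  have "inner_on I f (matvec I (poly_mat I A p) f) = inner_on I f (poly_op I A p f)" for f
    by (intro inner_on_cong matvec_poly_mat finite_index refl)
  with assms show ?thesis by (simp add: psd_poly_def psd_on_def)
qed

lemma l2_bounded_poly_mat:
  assumes "0 \<le> g" and upper: "psd_poly ([:g:] - p)" and square: "psd_poly (p * ([:g:] - p))"
  shows "l2_bounded I (poly_mat I A p) g"
proof -
  let ?M = "matvec I (poly_mat I A p)"
  have "inner_on I (?M f) (?M f) \<le> g\<^sup>2 * inner_on I f f" for f
  proof -
    let ?s = "inner_on I f (poly_op I A p f)"
    have "inner_on I (?M f) (?M f) = inner_on I (poly_op I A p f) (poly_op I A p f)"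
      by (intro inner_on_cong matvec_poly_mat finite_index)
    also have "\<dots> = inner_on I f (poly_op I A (p * p) f)"
      by (simp only: poly_op_mult poly_op_self_adjoint)
    also have "\<dots> = g * ?s - inner_on I f (poly_op I A (p * ([:g:] - p)) f)"
      by (simp add: poly_op_mult right_diff_distrib inner_on_diff_right inner_on_cmult_right
          mult.commute[of p "[:g:]"])
    also have "\<dots> \<le> g * ?s"
      using square by (simp add: psd_poly_def)
    also have "\<dots> = g * (g * inner_on I f f - inner_on I f (poly_op I A ([:g:] - p) f))"
      by (simp add: inner_on_diff_right inner_on_cmult_right)
    also have "\<dots> \<le> g * (g * inner_on I f f)"
      using upper assms(1) by (intro mult_left_mono) (simp_all add: psd_poly_def)
    finally show ?thesis by (simp add: power2_eq_square)
  qed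
  then show ?thesis by (simp add: l2_bounded_iff assms(1))
qed

end

section \<open>The Bernstein cone of an interval\<close>

inductive_set bernstein_cone :: "real \<Rightarrow> real \<Rightarrow> real poly set" for a b :: real where
  basis: "c \<ge> 0 \<Longrightarrow> smult c ([:-a, 1:] ^ i * [:b, -1:] ^ j) \<in> bernstein_cone a b"
| add: "p \<in> bernstein_cone a b \<Longrightarrow> q \<in> bernstein_cone a b \<Longrightarrow> p + q \<in> bernstein_cone a b"

lemma bernstein_cone_const: "0 \<le> c \<Longrightarrow> [:c:] \<in> bernstein_cone a b"
  using bernstein_cone.basis[of c a 0 b 0] by simp

lemma bernstein_cone_sum:
  "(\<And>i. i \<in> I \<Longrightarrow> p i \<in> bernstein_cone a b) \<Longrightarrow> (\<Sum>i\<in>I. p i) \<in> bernstein_cone a b"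
  using bernstein_cone_const[of 0 a b]
  by (induction I rule: infinite_finite_induct) (auto intro: bernstein_cone.add)

lemma bernstein_cone_mult:
  assumes "p \<in> bernstein_cone a b" "q \<in> bernstein_cone a b"
  shows "p * q \<in> bernstein_cone a b"
  using assms(1)
proof induction
  case (basis c i j)
  show ?case using assms(2)
  proof induction
    case (basis c' i' j')
    have "smult c ([:-a, 1:] ^ i * [:b, -1:] ^ j) * smult c' ([:-a, 1:] ^ i' * [:b, -1:] ^ j') =
      smult (c * c') ([:-a, 1:] ^ (i + i') * [:b, -1:] ^ (j + j'))"
      by (simp add: power_add mult_ac)
    also have "\<dots> \<in> bernstein_cone a b"
      using basis \<open>c \<ge> 0\<close> by (intro bernstein_cone.basis) auto
    finally show ?case .
  next
    case (add p q)
    then show ?case by (simp only: distrib_left) (rule bernstein_cone.add)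
  qed
next
  case (add p q)
  then show ?case by (simp only: distrib_right) (rule bernstein_cone.add)
qed

lemma bernstein_cone_smult:
  assumes "0 \<le> c" "p \<in> bernstein_cone a b"
  shows "smult c p \<in> bernstein_cone a b"
  using bernstein_cone_mult[OF bernstein_cone_const[OF assms(1)] assms(2)] by simp

lemma bernstein_cone_poly_nonneg:
  assumes "p \<in> bernstein_cone a b" "x \<in> {a..b}"
  shows "poly p x \<ge> 0"
  using assms by induction auto

definition bernstein_poly :: "real \<Rightarrow> real \<Rightarrow> nat \<Rightarrow> nat \<Rightarrow> real poly" where
  "bernstein_poly a b N k =
    smult (real (N choose k) / (b - a) ^ N) ([:-a, 1:] ^ k * [:b, -1:] ^ (N - k))"

lemma poly_bernstein_poly:
  assumes "a < b" "k \<le> N"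
  shows "poly (bernstein_poly a b N k) x = Bernstein N k ((x - a) / (b - a))"
proof -
  have "1 - (x - a) / (b - a) = (b - x) / (b - a)"
    using assms(1) by (simp add: field_simps)
  moreover have "(b - a) ^ N = (b - a) ^ k * (b - a) ^ (N - k)"
    using assms(2) by (simp flip: power_add)
  ultimately show ?thesis
    by (simp add: bernstein_poly_def Bernstein_def power_divide)
qed

lemma sum_bernstein_poly:
  assumes "a < b"
  shows "(\<Sum>k\<le>N. bernstein_poly a b N k) = 1"
proof -
  have "poly (\<Sum>k\<le>N. bernstein_poly a b N k) = poly 1"
    using assms by (simp add: fun_eq_iff poly_sum poly_bernstein_poly)
  then show ?thesis by (simp only: poly_eq_poly_eq_iff)
qed

lemma smult_bernstein_poly_in_cone:
  assumes "a < b" "0 \<le> c"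
  shows "smult c (bernstein_poly a b N k) \<in> bernstein_cone a b"
  using assms unfolding bernstein_poly_def smult_smult by (intro bernstein_cone.basis) auto

lemma ex_bernstein_cone_approx:
  fixes f :: "real \<Rightarrow> real"
  assumes "a < b" "0 < e" and cont: "continuous_on {a..b} f" and range: "f ` {a..b} \<subseteq> {0..1}"
  shows "\<exists>p \<in> bernstein_cone a b. 1 - p \<in> bernstein_cone a b \<and> (\<forall>x\<in>{a..b}. \<bar>f x - poly p x\<bar> < e)"
proof -
  define g where "g t = f (a + (b - a) * t)" for t
  have affine: "a + (b - a) * t \<in> {a..b}" if "t \<in> {0..1}" for t
  proof -
    have "0 \<le> (b - a) * t" "(b - a) * t \<le> b - a"
      using that assms(1) mult_left_le[of t "b - a"] by auto
    then show ?thesis unfolding atLeastAtMost_iff by linarith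
  qed
  have "continuous_on {0..1} g"
    unfolding g_def
    by (rule continuous_on_compose2[OF cont]) (intro continuous_intros, use affine in blast)
  from Bernstein_Weierstrass[OF this assms(2)]
  obtain N where approx: "\<And>t. t \<in> {0..1} \<Longrightarrow> \<bar>g t - (\<Sum>k\<le>N. g (k / N) * Bernstein N k t)\<bar> < e"
    by (metis order_refl)
  have sample: "g (real k / real N) \<in> {0..1}" if "k \<le> N" for k
  proof -
    have "real k / real N \<in> {0..1}"
      using that by (auto simp: divide_le_eq_1)
    from affine[OF this] range show ?thesis unfolding g_def by blast
  qed
  define p where "p = (\<Sum>k\<le>N. smult (g (k / N)) (bernstein_poly a b N k))"
  have compl: "1 - p = (\<Sum>k\<le>N. smult (1 - g (k / N)) (bernstein_poly a b N k))"
    using sum_bernstein_poly[OF assms(1), of N] by (simp add: p_def smult_diff_left sum_subtractf)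
  have "p \<in> bernstein_cone a b" "1 - p \<in> bernstein_cone a b"
    using sample assms(1) unfolding compl unfolding p_def
    by (auto intro!: bernstein_cone_sum smult_bernstein_poly_in_cone)
  moreover have "\<bar>f x - poly p x\<bar> < e" if "x \<in> {a..b}" for x
    using approx[of "(x - a) / (b - a)"] that assms(1)
    by (simp add: g_def p_def poly_sum poly_bernstein_poly)
  ultimately show ?thesis by blast
qed

locale bounded_symmetric_matrix = symmetric_matrix +
  fixes a b :: real
  assumes less: "a < b"
    and rayleigh_ge: "a * inner_on I f f \<le> inner_on I f (matvec I A f)"
    and rayleigh_le: "inner_on I f (matvec I A f) \<le> b * inner_on I f f"
begin

lemma psd_poly_lower: "psd_poly [:-a, 1:]"
  using rayleigh_ge
  by (simp add: psd_poly_def poly_op_linear inner_on_diff_right inner_on_cmult_right)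

lemma psd_poly_upper: "psd_poly [:b, -1:]"
  using rayleigh_le
  by (simp add: psd_poly_def poly_op_linear inner_on_diff_right inner_on_cmult_right)

lemma psd_poly_lower_upper: "psd_poly ([:-a, 1:] * [:b, -1:])"
proof -
  define q where "q = [:-a, 1:] * [:b, -1:]"
  have "smult (b - a) q = [:-a, 1:] * [:b, -1:] * [:-a, 1:] + [:b, -1:] * [:-a, 1:] * [:b, -1:]"
    by (simp add: q_def algebra_simps)
  then have "psd_poly (smult (b - a) q)"
    by (simp only: psd_poly_add psd_poly_conj psd_poly_lower psd_poly_upper)
  from psd_poly_smult[OF _ this, of "1 / (b - a)"] show ?thesis
    using less unfolding q_def[symmetric] by simp
qed

lemma psd_poly_bernstein_basis: "psd_poly ([:-a, 1:] ^ i * [:b, -1:] ^ j)"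
proof -
  let ?l = "[:-a, 1:]" and ?r = "[:b, -1:]"
  let ?half = "?l ^ (i div 2) * ?r ^ (j div 2)" and ?rest = "?l ^ (i mod 2) * ?r ^ (j mod 2)"
  have split: "q ^ k = q ^ (k div 2) * q ^ (k mod 2) * q ^ (k div 2)" for q :: "real poly" and k
    unfolding power_add[symmetric] by (rule arg_cong[where f = "\<lambda>k. q ^ k"]) presburger
  have "i mod 2 = 0 \<or> i mod 2 = 1" "j mod 2 = 0 \<or> j mod 2 = 1" by auto
  then have "psd_poly ?rest"
    using psd_poly_1 psd_poly_lower psd_poly_upper psd_poly_lower_upper by (elim disjE) simp_all
  then have "psd_poly (?half * ?rest * ?half)"
    by (rule psd_poly_conj)
  also have "?half * ?rest * ?half = ?l ^ i * ?r ^ j"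
    by (simp only: split[of ?l i] split[of ?r j] mult_ac)
  finally show ?thesis .
qed

lemma psd_poly_bernstein_cone:
  assumes "p \<in> bernstein_cone a b"
  shows "psd_poly p"
  using assms
proof induction
  case (basis c i j)
  then show ?case by (intro psd_poly_smult psd_poly_bernstein_basis)
next
  case (add p q)
  then show ?case by (intro psd_poly_add)
qed

lemma l2_bounded_bernstein_cone:
  assumes "0 \<le> g" "p \<in> bernstein_cone a b" "[:g:] - p \<in> bernstein_cone a b"
  shows "l2_bounded I (poly_mat I A p) g"
  using assms(1)
proof (rule l2_bounded_poly_mat)
  show "psd_poly ([:g:] - p)" "psd_poly (p * ([:g:] - p))"
    by (intro psd_poly_bernstein_cone bernstein_cone_mult assms)+
qed

end

section \<open>Nonbacktracking walks in regular graphs\<close>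

definition nbrs :: "'v set set \<Rightarrow> 'v \<Rightarrow> 'v set" where
  "nbrs G u = {v. {u, v} \<in> G}"

text \<open>\<open>nb_walks G k X u v\<close> counts the nonbacktracking walks of length \<open>k\<close> from \<open>u\<close> to \<open>v\<close> whose
  first step does not end in \<open>X\<close>.\<close>

primrec nb_walks :: "'v set set \<Rightarrow> nat \<Rightarrow> 'v set \<Rightarrow> 'v \<Rightarrow> 'v \<Rightarrow> nat" where
  "nb_walks G 0 X u v = of_bool (u = v)"
| "nb_walks G (Suc k) X u v = (\<Sum>w\<in>nbrs G u - X. nb_walks G k {u} w v)"

fun nb_poly :: "real \<Rightarrow> nat \<Rightarrow> real poly" where
  "nb_poly D 0 = 1"
| "nb_poly D (Suc 0) = [:0, 1:]"
| "nb_poly D (Suc (Suc k)) =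
    [:0, 1:] * nb_poly D (Suc k) - smult (if k = 0 then D else D - 1) (nb_poly D k)"

lemma nbrs_iff [simp]: "v \<in> nbrs G u \<longleftrightarrow> {u, v} \<in> G"
  by (simp add: nbrs_def)

lemma adj_matrix_commute: "adj_matrix G u v = adj_matrix G v u"
  by (simp add: adj_matrix_def insert_commute)

lemma adj_matrix_nonneg: "0 \<le> adj_matrix G u v"
  by (simp add: adj_matrix_def)

locale regular_graph =
  fixes V :: "'v set" and d :: nat and G :: "'v set set"
  assumes finite_V: "finite V"
    and edges: "G \<subseteq> {e. e \<subseteq> V \<and> card e = 2}"
    and degree: "v \<in> V \<Longrightarrow> card {e \<in> G. v \<in> e} = d"

lemma regular_graphs_eq: "regular_graphs n d = {G. regular_graph {..<n} d G}"
  by (auto simp: regular_graphs_def regular_graph_def)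

context regular_graph
begin

lemma edgeD:
  assumes "{u, v} \<in> G"
  shows "u \<in> V" "v \<in> V" "u \<noteq> v"
proof -
  have "{u, v} \<subseteq> V \<and> card {u, v} = 2"
    using edges assms by blast
  then show "u \<in> V" "v \<in> V" "u \<noteq> v" by auto
qed

lemma nbrs_subset: "nbrs G u \<subseteq> V"
  using edgeD by auto

lemma finite_nbrs [simp]: "finite (nbrs G u)"
  using nbrs_subset finite_V by (rule finite_subset)

lemma card_nbrs:
  assumes "u \<in> V"
  shows "card (nbrs G u) = d"
proof -
  have "bij_betw (\<lambda>v. {u, v}) (nbrs G u) {e \<in> G. u \<in> e}"
  proof (rule bij_betwI')
    fix v w assume "v \<in> nbrs G u" "w \<in> nbrs G u"
    then show "({u, v} = {u, w}) = (v = w)" by (auto simp: doubleton_eq_iff)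
  next
    fix e assume e: "e \<in> {e \<in> G. u \<in> e}"
    then have "card e = 2" using edges by blast
    then obtain x y where "e = {x, y}" by (auto simp: card_2_iff)
    with e have "e = {u, if x = u then y else x}" by auto
    with e show "\<exists>v\<in>nbrs G u. e = {u, v}" by (metis nbrs_iff mem_Collect_eq)
  qed auto
  then show ?thesis
    using degree[OF assms] bij_betw_same_card by metis
qed

sublocale adj: symmetric_matrix V "adj_matrix G"
  by unfold_locales (rule finite_V, rule adj_matrix_commute)

lemma matvec_adj: "matvec V (adj_matrix G) f u = (\<Sum>w\<in>nbrs G u. f w)"
proof -
  have "matvec V (adj_matrix G) f u = (\<Sum>w\<in>V \<inter> nbrs G u. f w)"
    by (simp add: matvec_def adj_matrix_def sum.inter_restrict finite_V if_distrib[of "\<lambda>x. x * _"]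
        cong: if_cong)
  also have "V \<inter> nbrs G u = nbrs G u" using nbrs_subset by auto
  finally show ?thesis .
qed

lemma sum_adj:
  assumes "u \<in> V"
  shows "(\<Sum>v\<in>V. adj_matrix G u v) = d"
  using matvec_adj[of "\<lambda>_. 1" u] card_nbrs[OF assms] by (simp add: matvec_def)

lemma sum_adj_square:
  assumes "s\<^sup>2 = 1"
  shows "(\<Sum>u\<in>V. \<Sum>v\<in>V. adj_matrix G u v * (f u + s * f v)\<^sup>2) =
    2 * (d * inner_on V f f + s * inner_on V f (matvec V (adj_matrix G) f))"
proof -
  let ?A = "adj_matrix G"
  have diag: "(\<Sum>u\<in>V. \<Sum>v\<in>V. ?A u v * (f u)\<^sup>2) = d * inner_on V f f"
    by (simp add: sum_adj inner_on_def power2_eq_square sum_distrib_left flip: sum_distrib_right)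
  then have diag': "(\<Sum>u\<in>V. \<Sum>v\<in>V. ?A u v * (f v)\<^sup>2) = d * inner_on V f f"
    by (subst sum.swap) (simp add: adj_matrix_commute[of G])
  have "(\<Sum>u\<in>V. \<Sum>v\<in>V. ?A u v * (f u + s * f v)\<^sup>2) =
      (\<Sum>u\<in>V. \<Sum>v\<in>V. ?A u v * (f u)\<^sup>2 + ?A u v * (f v)\<^sup>2 + 2 * s * (f u * (?A u v * f v)))"
    using assms by (intro sum.cong refl) (simp add: power2_sum power_mult_distrib algebra_simps)
  also have "\<dots> = 2 * (d * inner_on V f f + s * inner_on V f (matvec V ?A f))"
    unfolding sum.distrib diag diag' by (simp add: inner_on_def matvec_def sum_distrib_left mult_ac)
  finally show ?thesis .
qed

lemma bounded_symmetric_adj: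
  assumes "0 < d"
  shows "bounded_symmetric_matrix V (adj_matrix G) (- real d) (real d)"
proof unfold_locales
  have "0 \<le> d * inner_on V f f + s * inner_on V f (matvec V (adj_matrix G) f)" if "s\<^sup>2 = 1" for s f
    using sum_adj_square[OF that, of f]
    by (smt (verit) sum_nonneg mult_nonneg_nonneg adj_matrix_nonneg zero_le_power2)
  note psd = this[of 1] this[of "-1"]
  show "- real d * inner_on V f f \<le> inner_on V f (matvec V (adj_matrix G) f)"
    "inner_on V f (matvec V (adj_matrix G) f) \<le> real d * inner_on V f f" for f
    using psd[of f] by simp_all
qed (use assms in simp)

lemma nb_walks_split:
  assumes "{u, x} \<in> G"
  shows "nb_walks G (Suc k) {} u v = nb_walks G (Suc k) {x} u v + nb_walks G k {u} x v"
  using assms by (simp add: sum.remove[of "nbrs G u" x])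

lemma nb_walks_recurrence:
  assumes "u \<in> V"
  shows "(\<Sum>w\<in>nbrs G u. nb_walks G (Suc k) {} w v) + (if k = 0 then 0 else nb_walks G k {} u v) =
    nb_walks G (Suc (Suc k)) {} u v + d * nb_walks G k {} u v"
proof -
  let ?back = "\<Sum>w\<in>nbrs G u. nb_walks G k {w} u v"
  have "(\<Sum>w\<in>nbrs G u. nb_walks G (Suc k) {} w v) =
      (\<Sum>w\<in>nbrs G u. nb_walks G (Suc k) {u} w v + nb_walks G k {w} u v)"
    by (intro sum.cong nb_walks_split refl) (auto simp: insert_commute)
  also have "\<dots> = nb_walks G (Suc (Suc k)) {} u v + ?back"
    by (simp add: sum.distrib)
  moreover have "?back + (if k = 0 then 0 else nb_walks G k {} u v) = d * nb_walks G k {} u v"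
  proof (cases k)
    case 0
    then show ?thesis using card_nbrs[OF assms] by simp
  next
    case (Suc j)
    have "?back + nb_walks G k {} u v = (\<Sum>w\<in>nbrs G u. nb_walks G k {w} u v + nb_walks G j {u} w v)"
      by (simp add: sum.distrib Suc)
    also have "\<dots> = (\<Sum>w\<in>nbrs G u. nb_walks G k {} u v)"
      unfolding Suc by (intro sum.cong refl nb_walks_split[symmetric]) simp
    finally show ?thesis using card_nbrs[OF assms] Suc by simp
  qed
  ultimately show ?thesis by simp
qed

lemma poly_mat_nb_poly:
  assumes "u \<in> V" "v \<in> V"
  shows "poly_mat V (adj_matrix G) (nb_poly d k) u v = nb_walks G k {} u v"
  using assms(1)
proof (induction "real d" k arbitrary: u rule: nb_poly.induct)
  case 1
  then show ?case by (simp add: poly_mat_def)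
next
  case 2
  then show ?case
    by (simp add: poly_mat_def poly_op_linear matvec_adj)
next
  case (3 k)
  let ?P = "\<lambda>p. poly_mat V (adj_matrix G) p"
  have "?P ([:0, 1:] * nb_poly d (Suc k)) u v = (\<Sum>w\<in>nbrs G u. ?P (nb_poly d (Suc k)) w v)"
    unfolding poly_mat_def poly_op_mult by (simp add: poly_op_linear matvec_adj)
  also have "\<dots> = (\<Sum>w\<in>nbrs G u. real (nb_walks G (Suc k) {} w v))"
    using edgeD by (intro sum.cong refl 3) auto
  finally have "?P (nb_poly d (Suc (Suc k))) u v =
      real (\<Sum>w\<in>nbrs G u. nb_walks G (Suc k) {} w v) -
      (if k = 0 then real d else real d - 1) * nb_walks G k {} u v"
    using 3 by (simp add: poly_mat_def del: mult_pCons_left nb_walks.simps)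
  moreover have "real (\<Sum>w\<in>nbrs G u. nb_walks G (Suc k) {} w v) +
      real (if k = 0 then 0 else nb_walks G k {} u v) =
      real (nb_walks G (Suc (Suc k)) {} u v) + real (d * nb_walks G k {} u v)"
    using nb_walks_recurrence[OF 3(3), of k v] by (simp only: of_nat_add[symmetric])
  ultimately show ?case
    by (cases "k = 0") (simp_all add: left_diff_distrib del: nb_poly.simps nb_walks.simps(2))
qed

lemma sum_nb_walks_avoiding:
  assumes "{u, x} \<in> G"
  shows "(\<Sum>v\<in>V. nb_walks G k {x} u v) = (d - 1) ^ k"
  using assms
proof (induction k arbitrary: u x)
  case 0
  then show ?case using edgeD[OF 0] finite_V by (simp add: of_bool_def)
next
  case (Suc k)
  have "(\<Sum>v\<in>V. nb_walks G (Suc k) {x} u v) = (\<Sum>w\<in>nbrs G u - {x}. \<Sum>v\<in>V. nb_walks G k {u} w v)"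
    unfolding nb_walks.simps by (rule sum.swap)
  also have "\<dots> = (\<Sum>w\<in>nbrs G u - {x}. (d - 1) ^ k)"
    by (intro sum.cong refl Suc.IH) (auto simp: insert_commute)
  also have "\<dots> = (d - 1) ^ Suc k"
    using Suc.prems edgeD[OF Suc.prems] card_nbrs[of u] by (simp add: card_Diff_singleton)
  finally show ?case .
qed

lemma sum_nb_walks_Suc:
  assumes "u \<in> V"
  shows "(\<Sum>v\<in>V. nb_walks G (Suc k) {} u v) = d * (d - 1) ^ k"
proof -
  have "(\<Sum>v\<in>V. nb_walks G (Suc k) {} u v) = (\<Sum>w\<in>nbrs G u. \<Sum>v\<in>V. nb_walks G k {u} w v)"
    by (simp add: sum.swap[of _ V])
  also have "\<dots> = (\<Sum>w\<in>nbrs G u. (d - 1) ^ k)"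
    by (intro sum.cong refl sum_nb_walks_avoiding) (auto simp: insert_commute)
  finally show ?thesis using card_nbrs[OF assms] by simp
qed

end

section \<open>Vertices near short cycles\<close>

definition walks :: "'v set \<Rightarrow> 'v set set \<Rightarrow> nat \<Rightarrow> 'v list set" where
  "walks V G m = {w. length w = Suc m \<and> set w \<subseteq> V \<and> successively (\<lambda>x y. {x, y} \<in> G) w}"

text \<open>A lollipop is a path together with an edge from its last vertex back to a vertex before the
  last edge. Keeping the path from a bad vertex to the short cycle allows a single switching, at
  this closing edge, to bound the number of bad vertices.\<close>

definition lollipops :: "'v set \<Rightarrow> 'v set set \<Rightarrow> nat \<Rightarrow> ('v list \<times> 'v) set" where
  "lollipops V G m =
    {(w, b). w \<in> walks V G m \<and> distinct w \<and> b \<in> set (butlast (butlast w)) \<and> {last w, b} \<in> G}"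

definition bad_vertices :: "'v set \<Rightarrow> 'v set set \<Rightarrow> nat \<Rightarrow> 'v set" where
  "bad_vertices V G M = (\<Union>m\<le>M. (\<lambda>(w, b). hd w) ` lollipops V G m)"

lemma finite_walks:
  assumes "finite V"
  shows "finite (walks V G m)"
proof (rule finite_subset)
  show "walks V G m \<subseteq> {w. set w \<subseteq> V \<and> length w = Suc m}"
    by (auto simp: walks_def)
qed (simp add: finite_lists_length_eq assms)

lemma lollipops_subset: "lollipops V G m \<subseteq> (SIGMA w:walks V G m. set w)"
  by (auto simp: lollipops_def dest!: in_set_butlastD)

lemma finite_lollipops:
  assumes "finite V"
  shows "finite (lollipops V G m)"
  using assms by (intro finite_subset[OF lollipops_subset] finite_SigmaI finite_walks) auto

lemma bad_vertices_subset: "bad_vertices V G M \<subseteq> V"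
  by (force simp: bad_vertices_def lollipops_def walks_def length_Suc_conv)

lemma card_bad_vertices_le:
  assumes "finite V"
  shows "card (bad_vertices V G M) \<le> (\<Sum>m\<le>M. card (lollipops V G m))"
proof -
  have "card (bad_vertices V G M) \<le> (\<Sum>m\<le>M. card ((\<lambda>(w, b). hd w) ` lollipops V G m))"
    unfolding bad_vertices_def by (rule card_UN_le) simp
  also have "\<dots> \<le> (\<Sum>m\<le>M. card (lollipops V G m))"
    by (intro sum_mono card_image_le finite_lollipops assms)
  finally show ?thesis .
qed

context regular_graph
begin

lemma good_path_no_return:
  assumes good: "hd (w @ [x, y]) \<notin> bad_vertices V G M" and short: "Suc (length w) \<le> M"
    and path: "w @ [x, y] \<in> walks V G (Suc (length w))" "distinct (w @ [x, y])"
    and step: "{y, z} \<in> G" "z \<noteq> x"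
  shows "z \<notin> set (w @ [x, y])"
proof
  assume "z \<in> set (w @ [x, y])"
  then have "z \<in> set w" using step edgeD(3)[OF step(1)] by auto
  then have "(w @ [x, y], z) \<in> lollipops V G (Suc (length w))"
    using path step by (simp add: lollipops_def butlast_append)
  then show False
    using good short unfolding bad_vertices_def by force
qed

lemma nb_walks_leave_good_path:
  assumes "hd (w @ [x, y]) \<notin> bad_vertices V G M"
    and "w @ [x, y] \<in> walks V G (Suc (length w))" "distinct (w @ [x, y])"
    and "nb_walks G (Suc k) {x} y v > 0" and "Suc (length w) + k \<le> M"
  shows "v \<notin> set (w @ [x, y])"
  using assms
proof (induction k arbitrary: w x y)
  case 0
  then have "{y, v} \<in> G" "v \<noteq> x"
    by (auto simp: card_gt_0_iff)
  then show ?case using good_path_no_return[of w x y M v] 0 by simp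
next
  case (Suc k)
  from Suc.prems(4) obtain z where "z \<in> nbrs G y - {x}" "nb_walks G (Suc k) {y} z v \<noteq> 0"
    unfolding nb_walks.simps(2)[of G "Suc k"] by (metis sum.neutral less_irrefl)
  then have z: "{y, z} \<in> G" "z \<noteq> x" "nb_walks G (Suc k) {y} z v > 0"
    by (auto simp del: nb_walks.simps)
  have "z \<notin> set (w @ [x, y])"
    by (rule good_path_no_return[OF Suc.prems(1) _ Suc.prems(2,3) z(1,2)])
      (use Suc.prems(5) in simp)
  then have "v \<notin> set ((w @ [x]) @ [y, z])"
    using Suc.prems(1-3,5) z edgeD[OF z(1)]
    by (intro Suc.IH)
      (auto simp: walks_def successively_append_iff hd_append simp del: nb_walks.simps)
  then show ?case by simp
qed

lemma nb_walks_closed_eq_0: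
  assumes "u \<in> V - bad_vertices V G M" "0 < k" "k \<le> M"
  shows "nb_walks G k {} u u = 0"
proof (rule ccontr)
  assume nonzero: "nb_walks G k {} u u \<noteq> 0"
  obtain j where k_eq: "k = Suc j" using assms(2) gr0_implies_Suc by blast
  with nonzero obtain z where z_step: "{u, z} \<in> G" "nb_walks G j {u} z u > 0"
    by auto
  have "u \<notin> set ([] @ [u, z])" if "j = Suc i" for i
    using z_step edgeD[OF z_step(1)] assms k_eq that
    by (intro nb_walks_leave_good_path[of _ _ _ M i]) (auto simp: walks_def)
  then show False
    using z_step edgeD(3)[OF z_step(1)] by (cases j) auto
qed

end

section \<open>Existence of regular graphs\<close>

definition circulant_graph :: "nat \<Rightarrow> nat set \<Rightarrow> nat set set" where
  "circulant_graph n S = {{v, (v + s) mod n} |v s. v < n \<and> s \<in> S}"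

lemma mod_add_less:
  fixes n s v :: nat
  assumes "v < n" "s < n"
  shows "(v + s) mod n = (if v + s < n then v + s else v + s - n)"
  using assms by (auto simp: le_mod_geq)

lemma circulant_graph_incident:
  assumes S: "S \<subseteq> {0<..<n}" and sym: "\<And>s. s \<in> S \<Longrightarrow> n - s \<in> S" and v: "v < n"
  shows "{e \<in> circulant_graph n S. v \<in> e} = (\<lambda>s. {v, (v + s) mod n}) ` S"
proof (intro equalityI subsetI)
  fix e assume "e \<in> {e \<in> circulant_graph n S. v \<in> e}"
  then obtain u s where e: "e = {u, (u + s) mod n}" "u < n" "s \<in> S" "v = u \<or> v = (u + s) mod n"
    unfolding circulant_graph_def by blast
  have "(v + (n - s)) mod n = u" if "v = (u + s) mod n"
  proof -
    have "(v + (n - s)) mod n = (u + s + (n - s)) mod n"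
      unfolding that by (rule mod_add_left_eq)
    also have "u + s + (n - s) = u + n" using S e(3) by auto
    finally show ?thesis using e(2) by simp
  qed
  then have "v = (u + s) mod n \<Longrightarrow> e = {v, (v + (n - s)) mod n}"
    using e(1) by (simp add: insert_commute)
  then show "e \<in> (\<lambda>s. {v, (v + s) mod n}) ` S"
    using e sym by blast
qed (use v in \<open>auto simp: circulant_graph_def\<close>)

lemma circulant_graph_regular:
  assumes S: "S \<subseteq> {0<..<n}" and sym: "\<And>s. s \<in> S \<Longrightarrow> n - s \<in> S"
  shows "circulant_graph n S \<in> regular_graphs n (card S)"
proof -
  have shift_neq: "(v + s) mod n \<noteq> v" if "v < n" "s \<in> S" for v s
    using that S by (auto simp: mod_add_less subset_iff)
  have "inj_on (\<lambda>s. {v, (v + s) mod n}) S" if v: "v < n" for v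
  proof (rule inj_onI)
    fix s t assume same_edge: "s \<in> S" "t \<in> S" "{v, (v + s) mod n} = {v, (v + t) mod n}"
    then have "(v + s) mod n = (v + t) mod n"
      using shift_neq[OF v] by (auto simp: doubleton_eq_iff)
    moreover have "s < n" "t < n" using same_edge S by auto
    ultimately show "s = t"
      using v by (auto simp: mod_add_less split: if_splits)
  qed
  then have "card {e \<in> circulant_graph n S. v \<in> e} = card S" if "v < n" for v
    using that by (simp add: circulant_graph_incident[OF S sym] card_image)
  moreover have "circulant_graph n S \<subseteq> {e. e \<subseteq> {..<n} \<and> card e = 2}"
    using shift_neq not_sym[OF shift_neq] by (auto simp: circulant_graph_def card_insert_if)
  ultimately show ?thesis by (simp add: regular_graphs_def)
qed

lemma ex_symmetric_residues:
  fixes n d :: nat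
  assumes "d < n" "even (d * n)"
  shows "\<exists>S \<subseteq> {0<..<n}. (\<forall>s\<in>S. n - s \<in> S) \<and> card S = d"
proof -
  define h where "h = d div 2"
  define S where "S = {1..h} \<union> {n - h..<n} \<union> (if odd d then {n div 2} else {})"
  have n_even: "2 * (n div 2) = n" if "odd d"
    using assms(2) that by simp
  have d_half: "odd d \<Longrightarrow> Suc (2 * h) = d" "even d \<Longrightarrow> 2 * h = d"
    by (simp_all add: h_def)
  have h_less: "2 * h < n" "odd d \<Longrightarrow> h < n div 2"
  proof -
    show "2 * h < n" using assms(1) by (simp add: h_def)
    show "h < n div 2" if "odd d" using n_even[OF that] d_half(1)[OF that] assms(1) by linarith
  qed
  have "card ({1..h} \<union> {n - h..<n}) = 2 * h"
    using h_less(1) by (subst card_Un_disjoint) auto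
  moreover have "n div 2 \<notin> {1..h} \<union> {n - h..<n}" if "odd d"
    using h_less(2)[OF that] n_even[OF that] by auto
  ultimately have "card S = d"
    using d_half by (cases "odd d") (simp_all add: S_def)
  moreover have "S \<subseteq> {0<..<n}"
    using h_less n_even by (auto simp: S_def split: if_splits)
  moreover have "n - s \<in> S" if "s \<in> S" for s
  proof (cases "odd d \<and> s = n div 2")
    case True
    with n_even have "n - s = s" by auto
    with that show ?thesis by simp
  qed (use that h_less(1) in \<open>auto simp: S_def split: if_splits\<close>)
  ultimately show ?thesis by blast
qed

lemma regular_graphs_nonempty:
  assumes "d < n" "even (d * n)"
  shows "regular_graphs n d \<noteq> {}"
  using ex_symmetric_residues[OF assms] circulant_graph_regular by blast

section \<open>The Kesten-McKay measure\<close>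

lemma coeff_nb_poly: "coeff (nb_poly D k) k = 1" "k < i \<Longrightarrow> coeff (nb_poly D k) i = 0"
proof -
  have "coeff (nb_poly D k) k = 1 \<and> (\<forall>i>k. coeff (nb_poly D k) i = 0)"
  proof (induction D k rule: nb_poly.induct)
    case (3 D k)
    have "coeff (nb_poly D (Suc (Suc k))) i = 0" if "i > Suc (Suc k)" for i
      using 3 that by (cases i) auto
    then show ?case using 3 by auto
  qed (auto simp: coeff_pCons split: nat.splits)
  then show "coeff (nb_poly D k) k = 1" "k < i \<Longrightarrow> coeff (nb_poly D k) i = 0" by auto
qed

lemma degree_nb_poly: "degree (nb_poly D k) = k"
  by (intro antisym degree_le le_degree allI impI) (simp_all add: coeff_nb_poly)

lemma ex_nb_poly_expansion: "\<exists>c. p = (\<Sum>k\<le>degree p. smult (c k) (nb_poly D k))"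
proof -
  have "\<exists>c. p = (\<Sum>k\<le>N. smult (c k) (nb_poly D k))" if "degree p \<le> N" for N
    using that
  proof (induction N arbitrary: p)
    case 0
    then obtain a where "p = [:a:]" by (auto elim: degree_eq_zeroE)
    then show ?case by (intro exI[of _ "\<lambda>_. a"]) simp
  next
    case (Suc N)
    let ?a = "coeff p (Suc N)" and ?q = "nb_poly D (Suc N)"
    have "degree (p - smult ?a ?q) \<le> N"
    proof (rule degree_le, intro allI impI)
      fix i assume "N < i"
      then show "coeff (p - smult ?a ?q) i = 0"
        using Suc.prems
        by (cases "i = Suc N") (auto simp: coeff_nb_poly coeff_eq_0 simp del: nb_poly.simps)
    qed
    from Suc.IH[OF this] obtain c where "p - smult ?a ?q = (\<Sum>k\<le>N. smult (c k) (nb_poly D k))"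
      by blast
    then have "p = (\<Sum>k\<le>Suc N. smult ((c(Suc N := ?a)) k) (nb_poly D k))"
      by (simp add: algebra_simps)
    then show ?case by blast
  qed
  then show ?thesis by blast
qed

text \<open>Under \<open>x = 2 \<surd>(D - 1) cos \<theta>\<close> and with \<open>t = 1 / (D - 1)\<close>, the density of the Kesten-McKay
  measure is a multiple of \<open>sin\<^sup>2 \<theta>\<close> over \<open>\<bar>1 - t e\<^bsup>2i\<theta>\<^esup>\<bar>\<^sup>2\<close>, and the nonbacktracking polynomials are
  multiples of \<open>nb_sine t k \<theta> / sin \<theta>\<close>.\<close>

definition km_denom :: "real \<Rightarrow> real \<Rightarrow> real" where
  "km_denom t \<theta> = 1 - 2 * t * cos (2 * \<theta>) + t\<^sup>2"

definition nb_sine :: "real \<Rightarrow> nat \<Rightarrow> real \<Rightarrow> real" where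
  "nb_sine t k \<theta> = sin ((real k + 1) * \<theta>) - t * sin ((real k - 1) * \<theta>)"

definition km_density :: "real \<Rightarrow> real \<Rightarrow> real" where
  "km_density D \<theta> = 2 / pi * (1 + 1 / (D - 1)) * (sin \<theta>)\<^sup>2 / km_denom (1 / (D - 1)) \<theta>"

definition km :: "real \<Rightarrow> (real \<Rightarrow> real) \<Rightarrow> real" where
  "km D f = integral {0..pi} (\<lambda>\<theta>. f (2 * sqrt (D - 1) * cos \<theta>) * km_density D \<theta>)"

lemma km_denom_bounds:
  assumes "\<bar>t\<bar> \<le> 1"
  shows "(1 - \<bar>t\<bar>)\<^sup>2 \<le> km_denom t \<theta>" "km_denom t \<theta> \<le> (1 + \<bar>t\<bar>)\<^sup>2"
proof -
  have "\<bar>t * cos (2 * \<theta>)\<bar> \<le> \<bar>t\<bar> * 1"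
    unfolding abs_mult by (intro mult_left_mono) auto
  then show "(1 - \<bar>t\<bar>)\<^sup>2 \<le> km_denom t \<theta>" "km_denom t \<theta> \<le> (1 + \<bar>t\<bar>)\<^sup>2"
    by (auto simp: km_denom_def power2_eq_square algebra_simps abs_le_iff)
qed

lemma km_denom_pos:
  assumes "\<bar>t\<bar> < 1"
  shows "0 < km_denom t \<theta>"
proof -
  have "0 < (1 - \<bar>t\<bar>)\<^sup>2" using assms by simp
  also have "\<dots> \<le> km_denom t \<theta>" using assms by (intro km_denom_bounds) simp
  finally show ?thesis .
qed

lemma nb_sine_rec: "nb_sine t (Suc (Suc k)) \<theta> = 2 * cos \<theta> * nb_sine t (Suc k) \<theta> - nb_sine t k \<theta>"
proof -
  have "sin (x + \<theta>) = 2 * cos \<theta> * sin x - sin (x - \<theta>)" for x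
    by (simp add: sin_add sin_diff)
  from this[of "(real k + 2) * \<theta>"] arg_cong[OF this[of "real k * \<theta>"], of "(*) t"] show ?thesis
    by (simp add: nb_sine_def algebra_simps)
qed

lemma nb_sine_telescope:
  "nb_sine t k \<theta> - t * nb_sine t (k + 2) \<theta> = sin ((real k + 1) * \<theta>) * km_denom t \<theta>"
proof -
  let ?x = "(real k + 1) * \<theta>"
  have "sin (?x + 2 * \<theta>) = 2 * cos (2 * \<theta>) * sin ?x - sin (?x - 2 * \<theta>)"
    by (simp only: sin_add sin_diff) simp
  then have "sin ((real k + 3) * \<theta>) = 2 * cos (2 * \<theta>) * sin ?x - sin ((real k - 1) * \<theta>)"
    by (simp add: algebra_simps)
  from arg_cong[OF this, of "(*) t"] show ?thesis
    by (simp add: nb_sine_def km_denom_def power2_eq_square algebra_simps)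
qed

lemma poly_nb_poly_sin:
  assumes "D > 1"
  shows "poly (nb_poly D k) (2 * sqrt (D - 1) * cos \<theta>) * sin \<theta> =
    (if k = 0 then (D - 1) / D else 1) * sqrt (D - 1) ^ k * nb_sine (1 / (D - 1)) k \<theta>"
  using assms
proof (induction D k rule: nb_poly.induct)
  case (1 D)
  then show ?case by (simp add: nb_sine_def field_simps)
next
  case (2 D)
  then show ?case by (simp add: nb_sine_def sin_double)
next
  case (3 D k)
  let ?s = "sqrt (D - 1)" and ?f = "\<lambda>k. nb_sine (1 / (D - 1)) k \<theta>"
    and ?c = "if k = 0 then (D - 1) / D else 1" and ?e = "if k = 0 then D else D - 1"
  have "poly (nb_poly D (Suc (Suc k))) (2 * ?s * cos \<theta>) * sin \<theta> =
      2 * ?s * cos \<theta> * (poly (nb_poly D (Suc k)) (2 * ?s * cos \<theta>) * sin \<theta>) -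
      ?e * (poly (nb_poly D k) (2 * ?s * cos \<theta>) * sin \<theta>)"
    by (subst nb_poly.simps(3)) (simp add: algebra_simps del: nb_poly.simps)
  also have "\<dots> = 2 * cos \<theta> * ?s ^ (k + 2) * ?f (Suc k) - (?e * ?c) * ?s ^ k * ?f k"
    unfolding 3(1)[OF 3(3)] 3(2)[OF 3(3)] by (simp add: mult_ac)
  also have "?e * ?c = ?s ^ 2"
    using 3(3) by simp
  also have "2 * cos \<theta> * ?s ^ (k + 2) * ?f (Suc k) - ?s ^ 2 * ?s ^ k * ?f k =
      ?s ^ (k + 2) * (2 * cos \<theta> * ?f (Suc k) - ?f k)"
    by (simp only: power_add right_diff_distrib mult_ac)
  finally show ?case by (simp add: nb_sine_rec)
qed

lemma integral_sin_mult_sin: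
  "integral {0..pi} (\<lambda>\<theta>. sin \<theta> * sin ((real k + 1) * \<theta>)) = (if k = 0 then pi / 2 else 0)"
proof (cases "k = 0")
  case True
  have "((\<lambda>\<theta>. sin \<theta> * sin \<theta>) has_integral
      ((pi - sin (2 * pi) / 2) / 2 - (0 - sin (2 * 0) / 2) / 2)) {0..pi}"
    by (intro fundamental_theorem_of_calculus)
      (auto intro!: derivative_eq_intros simp flip: has_real_derivative_iff_has_vector_derivative
        simp: cos_double_sin power2_eq_square diff_divide_distrib)
  with True show ?thesis by (simp add: integral_unique)
next
  case False
  define F where "F \<theta> = (sin (k * \<theta>) / k - sin ((real k + 2) * \<theta>) / (real k + 2)) / 2" for \<theta> :: real
  have F_endpoints: "F pi = 0" "F 0 = 0"
    using sin_npi[of k] sin_npi[of "k + 2"] by (auto simp: F_def algebra_simps)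
  have "((\<lambda>\<theta>. (cos (real k * \<theta>) - cos ((real k + 2) * \<theta>)) / 2) has_integral (F pi - F 0)) {0..pi}"
    using False unfolding F_def
    by (intro fundamental_theorem_of_calculus)
      (auto intro!: derivative_eq_intros simp flip: has_real_derivative_iff_has_vector_derivative)
  moreover have "sin \<theta> * sin ((real k + 1) * \<theta>) =
      (cos (real k * \<theta>) - cos ((real k + 2) * \<theta>)) / 2" for \<theta>
    using cos_add[of "(real k + 1) * \<theta>" \<theta>] cos_diff[of "(real k + 1) * \<theta>" \<theta>]
    by (simp add: algebra_simps)
  ultimately have "((\<lambda>\<theta>. sin \<theta> * sin ((real k + 1) * \<theta>)) has_integral (F pi - F 0)) {0..pi}"
    by (simp only:)
  then show ?thesis
    using F_endpoints False by (simp add: integral_unique)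
qed

lemma bounded_geometric_orbit_eq_0:
  fixes t :: real and a :: "nat \<Rightarrow> real"
  assumes t_less: "\<bar>t\<bar> < 1" and step: "\<And>j. a j = t * a (Suc j)" and bound: "\<And>j. \<bar>a j\<bar> \<le> C"
  shows "a 0 = 0"
proof -
  have "a 0 = t ^ j * a j" for j
  proof (induction j)
    case (Suc j)
    then show ?case using step[of j] by simp
  qed simp
  then have "\<bar>a 0\<bar> \<le> \<bar>t\<bar> ^ j * C" for j
    using mult_left_mono[OF bound[of j], of "\<bar>t\<bar> ^ j"]
    by (metis abs_mult power_abs zero_le_power abs_ge_zero)
  moreover have "(\<lambda>j. \<bar>t\<bar> ^ j * C) \<longlonglongrightarrow> 0"
    using t_less by (intro tendsto_mult_left_zero LIMSEQ_power_zero) auto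
  ultimately have "\<bar>a 0\<bar> \<le> 0"
    using LIMSEQ_le_const by blast
  then show ?thesis by simp
qed

lemma continuous_on_nb_sine_quotient:
  assumes "\<bar>t\<bar> < 1"
  shows "continuous_on S (\<lambda>\<theta>. sin \<theta> * nb_sine t k \<theta> / km_denom t \<theta>)"
proof -
  have "\<forall>\<theta>\<in>S. km_denom t \<theta> \<noteq> 0"
    using km_denom_pos[OF assms] by (metis less_irrefl)
  then show ?thesis
    unfolding nb_sine_def km_denom_def by (intro continuous_intros)
qed

lemma integral_nb_sine_step:
  assumes t_less: "\<bar>t\<bar> < 1"
  shows "integral {0..pi} (\<lambda>\<theta>. sin \<theta> * nb_sine t k \<theta> / km_denom t \<theta>) =
    t * integral {0..pi} (\<lambda>\<theta>. sin \<theta> * nb_sine t (k + 2) \<theta> / km_denom t \<theta>) +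
    (if k = 0 then pi / 2 else 0)"
proof -
  let ?h = "\<lambda>k \<theta>. sin \<theta> * nb_sine t k \<theta> / km_denom t \<theta>"
  note integrable = integrable_continuous_real[OF continuous_on_nb_sine_quotient[OF t_less]]
  have "?h k \<theta> - t * ?h (k + 2) \<theta> = sin \<theta> * sin ((real k + 1) * \<theta>)" for \<theta>
  proof -
    have "?h k \<theta> - t * ?h (k + 2) \<theta> =
        sin \<theta> * (nb_sine t k \<theta> - t * nb_sine t (k + 2) \<theta>) / km_denom t \<theta>"
      by (simp add: right_diff_distrib diff_divide_distrib)
    then show ?thesis
      using km_denom_pos[OF t_less, of \<theta>] unfolding nb_sine_telescope by simp
  qed
  then have "integral {0..pi} (\<lambda>\<theta>. ?h k \<theta> - t * ?h (k + 2) \<theta>) = (if k = 0 then pi / 2 else 0)"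
    by (simp only: integral_sin_mult_sin)
  moreover have "integral {0..pi} (\<lambda>\<theta>. ?h k \<theta> - t * ?h (k + 2) \<theta>) =
      integral {0..pi} (?h k) - t * integral {0..pi} (?h (k + 2))"
    by (simp only: integral_diff[OF integrable integrable_on_mult_right[OF integrable]]
        integral_mult_right)
  ultimately show ?thesis by simp
qed

lemma abs_integral_nb_sine_le:
  assumes t_less: "\<bar>t\<bar> < 1"
  shows "\<bar>integral {0..pi} (\<lambda>\<theta>. sin \<theta> * nb_sine t k \<theta> / km_denom t \<theta>)\<bar> \<le> 2 / (1 - \<bar>t\<bar>)\<^sup>2 * pi"
proof -
  have "norm (integral {0..pi} (\<lambda>\<theta>. sin \<theta> * nb_sine t k \<theta> / km_denom t \<theta>)) \<le>
      2 / (1 - \<bar>t\<bar>)\<^sup>2 * (pi - 0)"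
  proof (intro integral_bound continuous_on_nb_sine_quotient t_less)
    fix \<theta>
    have "\<bar>t * sin ((real k - 1) * \<theta>)\<bar> \<le> 1 * 1"
      unfolding abs_mult using t_less by (intro mult_mono) auto
    then have "\<bar>nb_sine t k \<theta>\<bar> \<le> 2"
      unfolding nb_sine_def using abs_sin_le_one[of "(real k + 1) * \<theta>"] by linarith
    then have "\<bar>sin \<theta> * nb_sine t k \<theta>\<bar> \<le> 1 * 2"
      unfolding abs_mult by (intro mult_mono) auto
    then show "norm (sin \<theta> * nb_sine t k \<theta> / km_denom t \<theta>) \<le> 2 / (1 - \<bar>t\<bar>)\<^sup>2"
      using km_denom_bounds(1)[of t \<theta>] t_less unfolding real_norm_def abs_divide
      by (intro frac_le) auto
  qed auto
  then show ?thesis by simp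
qed

lemma integral_nb_sine:
  assumes t_less: "\<bar>t\<bar> < 1"
  shows "integral {0..pi} (\<lambda>\<theta>. sin \<theta> * nb_sine t k \<theta> / km_denom t \<theta>) =
    (if k = 0 then pi / 2 else 0)"
proof -
  let ?J = "\<lambda>k. integral {0..pi} (\<lambda>\<theta>. sin \<theta> * nb_sine t k \<theta> / km_denom t \<theta>)"
  have "?J (k + 2 * 0) = 0" if "k > 0" for k
  proof (rule bounded_geometric_orbit_eq_0[OF t_less, where a = "\<lambda>j. ?J (k + 2 * j)"])
    show "?J (k + 2 * j) = t * ?J (k + 2 * Suc j)" for j
      using integral_nb_sine_step[OF t_less, of "k + 2 * j"] that by simp
    show "\<bar>?J (k + 2 * j)\<bar> \<le> 2 / (1 - \<bar>t\<bar>)\<^sup>2 * pi" for j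
      by (rule abs_integral_nb_sine_le[OF t_less])
  qed
  then show ?thesis
    using integral_nb_sine_step[OF t_less, of k] by simp
qed

lemma continuous_on_km_density:
  assumes "D > 2"
  shows "continuous_on S (km_density D)"
proof -
  have "\<forall>\<theta>\<in>S. km_denom (1 / (D - 1)) \<theta> \<noteq> 0"
    using assms km_denom_pos[of "1 / (D - 1)"] by (simp add: less_imp_neq[symmetric])
  then show ?thesis
    unfolding km_density_def km_denom_def by (intro continuous_intros)
qed

lemma km_density_ge:
  assumes "D > 2"
  shows "(sin \<theta>)\<^sup>2 / 4 \<le> km_density D \<theta>"
proof -
  define t where "t = 1 / (D - 1)"
  have t_bounds: "0 < t" "t < 1" using assms by (auto simp: t_def)
  have "1 / 2 \<le> 1 / (1 + t)" using t_bounds by (simp add: field_simps)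
  from mult_left_mono[OF this zero_le_power2[of "sin \<theta>"]]
  have "(sin \<theta>)\<^sup>2 / 4 \<le> 1 / 2 * ((sin \<theta>)\<^sup>2 * (1 / (1 + t)))" by linarith
  also have "\<dots> = 1 / 2 * ((1 + t) * (sin \<theta>)\<^sup>2 / (1 + t)\<^sup>2)"
    using t_bounds by (simp add: power2_eq_square)
  also have "\<dots> \<le> 2 / pi * ((1 + t) * (sin \<theta>)\<^sup>2 / km_denom t \<theta>)"
    using t_bounds km_denom_pos[of t \<theta>] km_denom_bounds(2)[of t \<theta>] pi_less_4
    by (intro mult_mono divide_left_mono mult_nonneg_nonneg mult_pos_pos) (auto simp: field_simps)
  finally show ?thesis
    by (simp only: km_density_def t_def mult.assoc times_divide_eq_right)
qed

lemma km_density_nonneg: "D > 2 \<Longrightarrow> 0 \<le> km_density D \<theta>"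
  by (rule order_trans[OF _ km_density_ge]) simp

lemma km_support:
  assumes "D \<ge> 1"
  shows "2 * sqrt (D - 1) * cos \<theta> \<in> {-D..D}"
proof -
  have "\<bar>2 * sqrt (D - 1) * cos \<theta>\<bar> \<le> 2 * sqrt (D - 1) * 1"
    unfolding abs_mult using assms by (intro mult_mono) auto
  also have "\<dots> \<le> D"
    using assms arith_geo_mean_sqrt[of "D - 1" 1] by simp
  finally show ?thesis by (simp add: abs_le_iff minus_le_iff)
qed

lemma km_integrable:
  assumes "D > 2" "continuous_on {-D..D} f"
  shows "(\<lambda>\<theta>. f (2 * sqrt (D - 1) * cos \<theta>) * km_density D \<theta>) integrable_on {0..pi}"
proof (intro integrable_continuous_real continuous_on_mult continuous_on_km_density assms)
  show "continuous_on {0..pi} (\<lambda>\<theta>. f (2 * sqrt (D - 1) * cos \<theta>))"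
    by (rule continuous_on_compose2[OF assms(2)])
      (intro continuous_intros, use km_support[of D] assms(1) in auto)
qed

lemma km_mono:
  assumes "D > 2" "continuous_on {-D..D} f" "continuous_on {-D..D} g"
    and "\<And>x. x \<in> {-D..D} \<Longrightarrow> f x \<le> g x"
  shows "km D f \<le> km D g"
  unfolding km_def
proof (intro integral_le km_integrable assms(1-3))
  fix \<theta>
  have "1 \<le> D" using assms(1) by simp
  then show "f (2 * sqrt (D - 1) * cos \<theta>) * km_density D \<theta> \<le>
      g (2 * sqrt (D - 1) * cos \<theta>) * km_density D \<theta>"
    by (intro mult_right_mono assms(4) km_support km_density_nonneg assms(1))
qed

lemma km_add:
  assumes "D > 2" "continuous_on {-D..D} f" "continuous_on {-D..D} g"
  shows "km D (\<lambda>x. f x + g x) = km D f + km D g"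
  unfolding km_def distrib_right by (intro integral_add km_integrable assms)

lemma km_cmult: "km D (\<lambda>x. c * f x) = c * km D f"
  unfolding km_def mult.assoc by (rule integral_mult_right)

lemma km_poly_add: "D > 2 \<Longrightarrow> km D (poly (p + q)) = km D (poly p) + km D (poly q)"
  using km_add[of D "poly p" "poly q"] by (simp add: poly_add[abs_def] continuous_intros)

lemma km_poly_smult: "km D (poly (smult c p)) = c * km D (poly p)"
  using km_cmult[of D c "poly p"] by (simp add: poly_smult[abs_def])

lemma km_poly_diff: "D > 2 \<Longrightarrow> km D (poly (p - q)) = km D (poly p) - km D (poly q)"
  using km_poly_add[of D "p - q" q] by simp

lemma km_0 [simp]: "km D (\<lambda>_. 0) = 0" "km D (poly 0) = 0"
  by (simp_all add: km_def)

lemma km_poly_sum: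
  "D > 2 \<Longrightarrow> km D (poly (\<Sum>i\<in>I. p i)) = (\<Sum>i\<in>I. km D (poly (p i)))"
  by (induction I rule: infinite_finite_induct) (auto simp: km_poly_add)

lemma km_nb_poly:
  assumes D_gt_2: "D > 2"
  shows "km D (poly (nb_poly D k)) = (if k = 0 then 1 else 0)"
proof -
  define t where "t = 1 / (D - 1)"
  have t_facts: "\<bar>t\<bar> < 1" "(1 + t) * ((D - 1) / D) = 1"
    using D_gt_2 by (simp_all add: t_def field_simps)
  define C where "C = 2 / pi * (1 + t) * (if k = 0 then (D - 1) / D else 1) * sqrt (D - 1) ^ k"
  have "poly (nb_poly D k) (2 * sqrt (D - 1) * cos \<theta>) * km_density D \<theta> =
      C * (sin \<theta> * nb_sine t k \<theta> / km_denom t \<theta>)" for \<theta>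
  proof -
    have "poly (nb_poly D k) (2 * sqrt (D - 1) * cos \<theta>) * km_density D \<theta> =
        (poly (nb_poly D k) (2 * sqrt (D - 1) * cos \<theta>) * sin \<theta>) *
        (2 / pi * (1 + t) * sin \<theta> / km_denom t \<theta>)"
      by (simp add: km_density_def t_def power2_eq_square)
    then show ?thesis
      using D_gt_2 by (subst (asm) poly_nb_poly_sin) (auto simp: C_def t_def)
  qed
  then have "km D (poly (nb_poly D k)) = C * (if k = 0 then pi / 2 else 0)"
    by (simp only: km_def integral_mult_right integral_nb_sine[OF t_facts(1)])
  also have "\<dots> = (if k = 0 then (1 + t) * ((D - 1) / D) else 0)"
    using D_gt_2 by (simp add: C_def field_simps)
  finally show ?thesis by (simp only: t_facts(2))
qed

lemma km_const: "D > 2 \<Longrightarrow> km D (\<lambda>_. c) = c"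
  using km_nb_poly[of D 0] km_cmult[of D c "\<lambda>_. 1"] by (simp add: poly_1[abs_def])

lemma X_mult_nb_poly:
  "[:0, 1:] * nb_poly D (Suc k) =
    nb_poly D (Suc (Suc k)) + smult (if k = 0 then D else D - 1) (nb_poly D k)"
  by simp

lemma km_mult_nb_poly_eq_0:
  assumes D_gt_2: "D > 2" and "degree p < k"
  shows "km D (poly (p * nb_poly D k)) = 0"
  using assms(2)
proof (induction p arbitrary: k)
  case 0
  then show ?case by simp
next
  case (pCons a p)
  obtain j where k_eq: "k = Suc j" using pCons.prems by (cases k) auto
  have "pCons a p * nb_poly D k = smult a (nb_poly D k) + p * ([:0, 1:] * nb_poly D k)"
    by simp
  also have "p * ([:0, 1:] * nb_poly D k) =
      p * nb_poly D (Suc k) + smult (if j = 0 then D else D - 1) (p * nb_poly D j)"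
    unfolding k_eq X_mult_nb_poly by (simp only: distrib_left mult_smult_right)
  finally have expand: "pCons a p * nb_poly D k = smult a (nb_poly D k) +
      (p * nb_poly D (Suc k) + smult (if j = 0 then D else D - 1) (p * nb_poly D j))" .
  have "p = 0 \<or> degree p < j"
    using pCons.prems k_eq by (cases "p = 0") auto
  then have "km D (poly (p * nb_poly D (Suc k))) = 0" "km D (poly (p * nb_poly D j)) = 0"
    using pCons.IH[of "Suc k"] pCons.IH[of j] k_eq by (auto simp del: nb_poly.simps poly_mult)
  then show ?case
    unfolding expand km_poly_add[OF D_gt_2] km_poly_smult using km_nb_poly[OF D_gt_2, of k] k_eq
    by (simp del: nb_poly.simps mult_pCons_left)
qed

lemma km_nb_poly_orthogonal:
  assumes "D > 2" "j \<noteq> k"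
  shows "km D (poly (nb_poly D j * nb_poly D k)) = 0"
proof (cases "j < k")
  case True
  then show ?thesis by (intro km_mult_nb_poly_eq_0 assms) (simp add: degree_nb_poly)
next
  case False
  then show ?thesis
    using assms(2)
    by (subst mult.commute) (intro km_mult_nb_poly_eq_0 assms(1), simp add: degree_nb_poly)
qed

lemma km_nb_poly_square:
  assumes D_gt_2: "D > 2"
  shows "km D (poly (nb_poly D (Suc k) * nb_poly D (Suc k))) = D * (D - 1) ^ k"
proof (induction k)
  case 0
  have "nb_poly D (Suc 0) * nb_poly D (Suc 0) = nb_poly D 2 + smult D (nb_poly D 0)"
    by (simp add: numeral_2_eq_2)
  then show ?case
    using km_nb_poly[OF D_gt_2, of 2] km_nb_poly[OF D_gt_2, of 0]
    by (simp only: km_poly_add[OF D_gt_2] km_poly_smult) simp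
next
  case (Suc k)
  let ?Q = "nb_poly D" and ?c = "if k = 0 then D else D - 1"
  have "?Q (Suc (Suc k)) * ?Q (Suc (Suc k)) =
      ?Q (Suc k) * ([:0, 1:] * ?Q (Suc (Suc k))) - smult ?c (?Q k * ?Q (Suc (Suc k)))"
  proof -
    have "?Q (Suc (Suc k)) * q = ?Q (Suc k) * ([:0, 1:] * q) - smult ?c (?Q k * q)" for q
      by (simp add: algebra_simps)
    then show ?thesis .
  qed
  also have "?Q (Suc k) * ([:0, 1:] * ?Q (Suc (Suc k))) =
      ?Q (Suc k) * ?Q (Suc (Suc (Suc k))) + smult (D - 1) (?Q (Suc k) * ?Q (Suc k))"
    unfolding X_mult_nb_poly by (simp add: distrib_left del: nb_poly.simps)
  finally show ?case
    using Suc km_nb_poly_orthogonal[OF D_gt_2, of "Suc k" "Suc (Suc (Suc k))"]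
      km_nb_poly_orthogonal[OF D_gt_2, of k "Suc (Suc k)"]
    by (simp only: km_poly_add[OF D_gt_2] km_poly_diff[OF D_gt_2] km_poly_smult) simp
qed

lemma bessel_nb_poly:
  assumes D_gt_2: "D > 2" and expansion: "p = (\<Sum>j\<le>N. smult (c j) (nb_poly D j))" and k_le: "k \<le> N"
  shows "(c k)\<^sup>2 * km D (poly (nb_poly D k * nb_poly D k)) \<le> km D (poly (p * p))"
proof -
  let ?q = "nb_poly D k" and ?r = "p - smult (c k) (nb_poly D k)"
  let ?N = "km D (poly (?q * ?q))"
  have "p * ?q = (\<Sum>j\<le>N. smult (c j) (nb_poly D j * ?q))"
    by (simp add: expansion sum_distrib_right)
  then have "km D (poly (p * ?q)) = (\<Sum>j\<le>N. c j * km D (poly (nb_poly D j * ?q)))"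
    by (simp only: km_poly_sum[OF D_gt_2] km_poly_smult)
  also have "\<dots> = (\<Sum>j\<le>N. if j = k then c j * ?N else 0)"
    by (intro sum.cong refl) (simp add: km_nb_poly_orthogonal[OF D_gt_2] del: poly_mult)
  also have "\<dots> = c k * ?N" using k_le by simp
  finally have cross: "km D (poly (p * ?q)) = c k * ?N" .
  have "0 = km D (poly 0)" by simp
  also have "\<dots> \<le> km D (poly (?r * ?r))"
    by (intro km_mono D_gt_2 continuous_intros) simp
  also have "?r * ?r = p * p - smult (2 * c k) (p * ?q) + smult ((c k)\<^sup>2) (?q * ?q)"
    by (simp add: algebra_simps power2_eq_square smult_add_left[symmetric])
  finally show ?thesis
    by (simp only: km_poly_add[OF D_gt_2] km_poly_diff[OF D_gt_2] km_poly_smult cross)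
      (simp add: power2_eq_square)
qed

section \<open>Test polynomials\<close>

definition bump :: "real \<Rightarrow> real \<Rightarrow> real" where
  "bump \<epsilon> y = min 1 (max 0 (- y - (1 - \<epsilon>)))"

definition bump_mass :: "real \<Rightarrow> real" where
  "bump_mass \<epsilon> = integral {0..pi} (\<lambda>\<theta>. bump \<epsilon> (cos \<theta>) * ((sin \<theta>)\<^sup>2 / 4))"

lemma bump_range: "0 \<le> bump \<epsilon> y" "bump \<epsilon> y \<le> 1"
  by (simp_all add: bump_def)

lemma bump_supported: "y * bump \<epsilon> y \<le> - (1 - \<epsilon>) * bump \<epsilon> y"
proof (cases "y \<le> - (1 - \<epsilon>)")
  case True
  then show ?thesis using bump_range(1) by (rule mult_right_mono)
next
  case False
  then have "bump \<epsilon> y = 0" by (simp add: bump_def)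
  then show ?thesis by simp
qed

lemma continuous_on_bump: "continuous_on S f \<Longrightarrow> continuous_on S (\<lambda>x. bump \<epsilon> (f x))"
  unfolding bump_def by (intro continuous_intros)

lemma continuous_on_bump_cos: "continuous_on S (\<lambda>\<theta>. bump \<epsilon> (cos \<theta>) * ((sin \<theta>)\<^sup>2 / 4))"
  by (intro continuous_intros continuous_on_bump) auto

lemma bump_mass_pos:
  assumes "0 < \<epsilon>" "\<epsilon> < 1"
  shows "0 < bump_mass \<epsilon>"
proof -
  define \<theta> where "\<theta> = arccos (- (1 - \<epsilon> / 2))"
  have \<theta>: "\<theta> \<in> {0..pi}" "cos \<theta> = - (1 - \<epsilon> / 2)"
    using assms by (auto simp: \<theta>_def arccos_lbound arccos_ubound)
  have "(cos \<theta>)\<^sup>2 < 1"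
    using assms \<theta>(2) by (simp add: abs_square_less_1)
  then have "sin \<theta> \<noteq> 0"
    using sin_squared_eq[of \<theta>] by auto
  moreover have "bump \<epsilon> (cos \<theta>) > 0"
    using assms \<theta>(2) by (simp add: bump_def)
  ultimately have "bump \<epsilon> (cos \<theta>) * ((sin \<theta>)\<^sup>2 / 4) \<noteq> 0"
    by simp
  with \<theta>(1) have "bump_mass \<epsilon> \<noteq> 0"
    unfolding bump_mass_def using continuous_on_bump_cos[of "{0..pi}" \<epsilon>]
    by (subst integral_eq_0_iff) (auto simp: bump_range)
  moreover have "0 \<le> bump_mass \<epsilon>"
    unfolding bump_mass_def
    by (intro integral_nonneg integrable_continuous_real continuous_on_bump_cos)
      (simp add: bump_range)
  ultimately show ?thesis by simp
qed

definition scaled_bump :: "real \<Rightarrow> real \<Rightarrow> real \<Rightarrow> real" where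
  "scaled_bump D \<epsilon> x = bump \<epsilon> (x / (2 * sqrt (D - 1)))"

lemma continuous_on_scaled_bump: "D > 1 \<Longrightarrow> continuous_on S (scaled_bump D \<epsilon>)"
  unfolding scaled_bump_def by (intro continuous_on_bump continuous_intros) auto

lemma bump_mass_le_km:
  assumes D_gt_2: "D > 2"
  shows "bump_mass \<epsilon> \<le> km D (scaled_bump D \<epsilon>)"
  unfolding bump_mass_def km_def
proof (rule integral_le)
  show "(\<lambda>\<theta>. bump \<epsilon> (cos \<theta>) * ((sin \<theta>)\<^sup>2 / 4)) integrable_on {0..pi}"
    by (intro integrable_continuous_real continuous_on_bump_cos)
  show "(\<lambda>\<theta>. scaled_bump D \<epsilon> (2 * sqrt (D - 1) * cos \<theta>) * km_density D \<theta>) integrable_on {0..pi}"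
    using D_gt_2 by (intro km_integrable continuous_on_scaled_bump) auto
  have "scaled_bump D \<epsilon> (2 * sqrt (D - 1) * cos \<theta>) = bump \<epsilon> (cos \<theta>)" for \<theta>
    using D_gt_2 by (simp add: scaled_bump_def)
  then show "bump \<epsilon> (cos \<theta>) * ((sin \<theta>)\<^sup>2 / 4) \<le>
      scaled_bump D \<epsilon> (2 * sqrt (D - 1) * cos \<theta>) * km_density D \<theta>" for \<theta>
    by (simp only: mult_left_mono km_density_ge[OF D_gt_2] bump_range)
qed

lemma km_affine_mult_scaled_bump_le:
  assumes D_gt_2: "D > 2"
  shows "km D (\<lambda>x. ((1 - 2 * \<epsilon>) * (2 * sqrt (D - 1)) + x) * scaled_bump D \<epsilon> x) \<le>
    - \<epsilon> * (2 * sqrt (D - 1)) * km D (scaled_bump D \<epsilon>)"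
proof -
  let ?\<rho> = "2 * sqrt (D - 1)" and ?q = "scaled_bump D \<epsilon>"
  have "((1 - 2 * \<epsilon>) * ?\<rho> + x) * ?q x \<le> - \<epsilon> * ?\<rho> * ?q x" for x
  proof -
    have "x * ?q x \<le> - (1 - \<epsilon>) * ?\<rho> * ?q x"
      using mult_left_mono[OF bump_supported[of "x / ?\<rho>" \<epsilon>], of ?\<rho>] D_gt_2
      by (simp add: scaled_bump_def mult_ac)
    then show ?thesis by (simp add: algebra_simps)
  qed
  then have "km D (\<lambda>x. ((1 - 2 * \<epsilon>) * ?\<rho> + x) * ?q x) \<le> km D (\<lambda>x. - \<epsilon> * ?\<rho> * ?q x)"
    using D_gt_2 by (intro km_mono continuous_on_scaled_bump continuous_intros) auto
  then show ?thesis by (simp only: km_cmult)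
qed

lemma abs_km_diff_le:
  assumes D_gt_2: "D > 2"
    and cont_f: "continuous_on {-D..D} f" and cont_g: "continuous_on {-D..D} g"
    and close: "\<And>x. x \<in> {-D..D} \<Longrightarrow> \<bar>f x - g x\<bar> \<le> \<delta>"
  shows "\<bar>km D f - km D g\<bar> \<le> \<delta>"
proof -
  have "km D h \<le> km D k + \<delta>"
    if "continuous_on {-D..D} h" "continuous_on {-D..D} k"
      and "\<And>x. x \<in> {-D..D} \<Longrightarrow> h x \<le> k x + \<delta>" for h k
  proof -
    have "km D h \<le> km D (\<lambda>x. k x + \<delta>)"
      using that by (intro km_mono D_gt_2 continuous_intros)
    also have "\<dots> = km D k + \<delta>"
      using that by (simp add: km_add[OF D_gt_2] km_const[OF D_gt_2])
    finally show ?thesis .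
  qed
  from this[OF cont_f cont_g] this[OF cont_g cont_f] close show ?thesis
    by (fastforce simp: abs_le_iff)
qed

lemma abs_km_affine_mult_diff_le:
  assumes D_gt_2: "D > 2" and cont: "continuous_on {-D..D} f" "continuous_on {-D..D} g"
    and close: "\<And>x. x \<in> {-D..D} \<Longrightarrow> \<bar>f x - g x\<bar> \<le> \<delta>"
  shows "\<bar>km D (\<lambda>x. (c + x) * f x) - km D (\<lambda>x. (c + x) * g x)\<bar> \<le> (\<bar>c\<bar> + D) * \<delta>"
proof (intro abs_km_diff_le D_gt_2 cont continuous_intros)
  fix x assume x_in: "x \<in> {-D..D}"
  have "\<bar>c + x\<bar> * \<bar>f x - g x\<bar> \<le> (\<bar>c\<bar> + D) * \<delta>"
    using x_in close[OF x_in] D_gt_2 by (intro mult_mono) auto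
  then show "\<bar>(c + x) * f x - (c + x) * g x\<bar> \<le> (\<bar>c\<bar> + D) * \<delta>"
    by (simp flip: abs_mult right_diff_distrib)
qed

lemma km_affine_mult_approx_scaled_bump_le_0:
  fixes D \<epsilon> :: real
  defines "\<rho> \<equiv> 2 * sqrt (D - 1)"
  assumes D_gt_2: "D > 2" and eps_pos: "0 < \<epsilon>" and cont: "continuous_on {-D..D} f"
    and close: "\<And>x. x \<in> {-D..D} \<Longrightarrow> \<bar>f x - scaled_bump D \<epsilon> x\<bar> \<le> \<delta>"
    and small: "(\<bar>(1 - 2 * \<epsilon>) * \<rho>\<bar> + D) * \<delta> \<le> \<epsilon> * \<rho> * bump_mass \<epsilon>"
  shows "km D (\<lambda>x. ((1 - 2 * \<epsilon>) * \<rho> + x) * f x) \<le> 0"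
proof -
  let ?q = "scaled_bump D \<epsilon>" and ?c = "(1 - 2 * \<epsilon>) * \<rho>"
  have cont_q: "continuous_on {-D..D} ?q" using D_gt_2 by (intro continuous_on_scaled_bump) simp
  have "km D (\<lambda>x. (?c + x) * f x) \<le> km D (\<lambda>x. (?c + x) * ?q x) + (\<bar>?c\<bar> + D) * \<delta>"
    using abs_km_affine_mult_diff_le[OF D_gt_2 cont cont_q close, of ?c] by simp
  also have "\<dots> \<le> - \<epsilon> * \<rho> * km D ?q + \<epsilon> * \<rho> * bump_mass \<epsilon>"
    using small unfolding \<rho>_def by (intro add_mono km_affine_mult_scaled_bump_le D_gt_2)
  also have "\<dots> \<le> 0"
    using bump_mass_le_km[OF D_gt_2, of \<epsilon>] eps_pos D_gt_2 by (simp add: \<rho>_def mult_left_mono)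
  finally show ?thesis .
qed

lemma ex_unnormalized_test_polynomial:
  assumes eps_bounds: "0 < \<epsilon>" "\<epsilon> < 1" and D_gt_2: "D > 2"
  shows "\<exists>p \<in> bernstein_cone (- D) D. 1 - p \<in> bernstein_cone (- D) D \<and>
    bump_mass \<epsilon> / 2 \<le> km D (poly p) \<and>
    km D (poly ([:(1 - 2 * \<epsilon>) * (2 * sqrt (D - 1)), 1:] * p)) \<le> 0"
proof -
  let ?q = "scaled_bump D \<epsilon>"
  define \<rho> where "\<rho> = 2 * sqrt (D - 1)"
  define c where "c = (1 - 2 * \<epsilon>) * \<rho>"
  define m where "m = bump_mass \<epsilon>"
  have \<rho>: "\<rho> > 0" using D_gt_2 by (simp add: \<rho>_def)
  have m_pos: "m > 0" unfolding m_def by (rule bump_mass_pos[OF eps_bounds])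
  have cont: "continuous_on {-D..D} ?q" using D_gt_2 by (intro continuous_on_scaled_bump) simp
  define \<delta> where "\<delta> = min (m / 2) (\<epsilon> * \<rho> * m / (\<bar>c\<bar> + D))"
  have "\<delta> > 0" using m_pos eps_bounds \<rho> D_gt_2 by (simp add: \<delta>_def add_nonneg_pos)
  moreover have "- D < D" "?q ` {-D..D} \<subseteq> {0..1}"
    using D_gt_2 by (auto simp: scaled_bump_def bump_range)
  ultimately obtain p where p_in_cone: "p \<in> bernstein_cone (- D) D" "1 - p \<in> bernstein_cone (- D) D"
    and "\<And>x. x \<in> {-D..D} \<Longrightarrow> \<bar>?q x - poly p x\<bar> < \<delta>"
    using ex_bernstein_cone_approx[OF _ _ cont] by blast
  then have close: "\<And>x. x \<in> {-D..D} \<Longrightarrow> \<bar>poly p x - ?q x\<bar> \<le> \<delta>"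
    by (simp add: abs_minus_commute less_imp_le)
  have "\<bar>km D (poly p) - km D ?q\<bar> \<le> \<delta>"
    by (intro abs_km_diff_le D_gt_2 cont close continuous_intros)
  moreover have "\<delta> \<le> m / 2" unfolding \<delta>_def by (rule min.cobounded1)
  ultimately have "m / 2 \<le> km D (poly p)"
    using bump_mass_le_km[OF D_gt_2, of \<epsilon>] unfolding m_def by linarith
  moreover have "\<delta> \<le> \<epsilon> * \<rho> * m / (\<bar>c\<bar> + D)" by (simp add: \<delta>_def)
  then have "(\<bar>c\<bar> + D) * \<delta> \<le> \<epsilon> * \<rho> * m"
    using D_gt_2 by (subst mult.commute) (simp add: pos_le_divide_eq add_nonneg_pos)
  then have "km D (\<lambda>x. (c + x) * poly p x) \<le> 0"
    unfolding c_def \<rho>_def m_def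
    by (intro km_affine_mult_approx_scaled_bump_le_0[OF D_gt_2 eps_bounds(1) _ close]
        continuous_intros)
  moreover have "(\<lambda>x. (c + x) * poly p x) = poly ([:c, 1:] * p)"
    by (auto simp: algebra_simps)
  ultimately show ?thesis
    using p_in_cone unfolding c_def \<rho>_def m_def by (intro bexI[of _ p]) auto
qed

definition test_polynomial :: "real \<Rightarrow> real \<Rightarrow> real \<Rightarrow> real poly \<Rightarrow> bool" where
  "test_polynomial D \<gamma> s p \<longleftrightarrow> p \<in> bernstein_cone (- D) D \<and> [:\<gamma>:] - p \<in> bernstein_cone (- D) D \<and>
    km D (poly p) = 1 \<and> km D (poly ([:0, 1:] * p)) \<le> - s"

lemma test_polynomial_mono: "test_polynomial D \<gamma> t p \<Longrightarrow> s \<le> t \<Longrightarrow> test_polynomial D \<gamma> s p"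
  by (simp add: test_polynomial_def)

lemma test_polynomial_normalize:
  assumes D_gt_2: "D > 2"
    and q_in_cone: "q \<in> bernstein_cone (- D) D" "1 - q \<in> bernstein_cone (- D) D"
    and m_bounds: "0 < m" "m \<le> km D (poly q)" and objective: "km D (poly ([:s, 1:] * q)) \<le> 0"
  shows "test_polynomial D (1 / m) s (smult (1 / km D (poly q)) q)"
proof -
  define c where "c = km D (poly q)"
  let ?p = "smult (1 / c) q"
  have c_bounds: "0 < c" "1 / c \<le> 1 / m" using m_bounds by (auto simp: c_def frac_le)
  have "[:1 / m:] - ?p = smult (1 / c) (1 - q) + [:1 / m - 1 / c:]"
    by (simp add: smult_diff_right one_pCons)
  also have "\<dots> \<in> bernstein_cone (- D) D"
    using c_bounds q_in_cone
    by (intro bernstein_cone.add bernstein_cone_smult bernstein_cone_const) auto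
  finally have "[:1 / m:] - ?p \<in> bernstein_cone (- D) D" .
  moreover have "?p \<in> bernstein_cone (- D) D"
    using c_bounds q_in_cone by (intro bernstein_cone_smult) auto
  moreover have "km D (poly ?p) = 1"
    using c_bounds by (simp only: km_poly_smult c_def[symmetric]) simp
  moreover have "km D (poly ([:0, 1:] * ?p)) \<le> - s"
  proof -
    have "[:s, 1:] * q = smult s q + [:0, 1:] * q" by simp
    with objective have "s * c + km D (poly ([:0, 1:] * q)) \<le> 0"
      by (simp only: km_poly_add[OF D_gt_2] km_poly_smult c_def)
    then have "km D (poly ([:0, 1:] * q)) / c \<le> - s"
      using c_bounds(1) by (simp add: pos_divide_le_eq)
    then show ?thesis by (simp only: mult_smult_right km_poly_smult) simp
  qed
  ultimately show ?thesis by (simp add: test_polynomial_def c_def)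
qed

lemma ex_test_polynomial:
  assumes "0 < \<epsilon>"
  shows "\<exists>\<gamma>>0. \<forall>D>2. \<exists>p. test_polynomial D \<gamma> ((1 - 2 * \<epsilon>) * (2 * sqrt (D - 1))) p"
proof -
  define \<epsilon>' where "\<epsilon>' = min \<epsilon> (1 / 2)"
  have eps_bounds: "0 < \<epsilon>'" "\<epsilon>' < 1" "\<epsilon>' \<le> \<epsilon>" using assms by (auto simp: \<epsilon>'_def)
  define m where "m = bump_mass \<epsilon>' / 2"
  have m_pos: "0 < m" using bump_mass_pos[OF eps_bounds(1,2)] by (simp add: m_def)
  have "\<exists>p. test_polynomial D (1 / m) ((1 - 2 * \<epsilon>) * (2 * sqrt (D - 1))) p" if D_gt_2: "D > 2" for D
  proof -
    obtain q where "q \<in> bernstein_cone (- D) D" "1 - q \<in> bernstein_cone (- D) D"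
      "m \<le> km D (poly q)" "km D (poly ([:(1 - 2 * \<epsilon>') * (2 * sqrt (D - 1)), 1:] * q)) \<le> 0"
      using ex_unnormalized_test_polynomial[OF eps_bounds(1,2) D_gt_2] unfolding m_def by blast
    note test_polynomial_normalize[OF D_gt_2 this(1,2) m_pos this(3,4)]
    moreover have "(1 - 2 * \<epsilon>) * (2 * sqrt (D - 1)) \<le> (1 - 2 * \<epsilon>') * (2 * sqrt (D - 1))"
      using eps_bounds(3) D_gt_2 by (intro mult_right_mono) auto
    ultimately show ?thesis by (blast intro: test_polynomial_mono)
  qed
  with m_pos show ?thesis by (intro exI[of _ "1 / m"]) simp
qed

lemma test_polynomial_bounds:
  assumes D_gt_2: "D > 2" and test: "test_polynomial D \<gamma> s p"
  shows "1 \<le> \<gamma>" "km D (poly (p * p)) \<le> \<gamma>\<^sup>2"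
proof -
  have p_facts: "p \<in> bernstein_cone (- D) D" "[:\<gamma>:] - p \<in> bernstein_cone (- D) D"
    "km D (poly p) = 1"
    using test by (auto simp: test_polynomial_def)
  have range: "0 \<le> poly p x" "poly p x \<le> \<gamma>" if "x \<in> {-D..D}" for x
    using p_facts(1,2)[THEN bernstein_cone_poly_nonneg, OF that] by simp_all
  have "km D (poly p) \<le> km D (\<lambda>_. \<gamma>)"
    using range by (intro km_mono D_gt_2 continuous_intros)
  then show "1 \<le> \<gamma>" by (simp add: p_facts(3) km_const[OF D_gt_2])
  then have "km D (poly (p * p)) \<le> km D (\<lambda>_. \<gamma>\<^sup>2)"
    using range by (intro km_mono D_gt_2 continuous_intros)
      (auto simp: power2_eq_square intro!: mult_mono)
  then show "km D (poly (p * p)) \<le> \<gamma>\<^sup>2" by (simp add: km_const[OF D_gt_2])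
qed

section \<open>Polynomials of the adjacency matrix at good vertices\<close>

context regular_graph
begin

lemma poly_mat_good_diag:
  assumes d_gt_2: "2 < d" and u_good: "u \<in> V - bad_vertices V G M" and degree_le: "degree p \<le> M"
  shows "poly_mat V (adj_matrix G) p u u = km d (poly p)"
proof -
  have real_d_gt_2: "real d > 2" using d_gt_2 by simp
  obtain c where expansion: "p = (\<Sum>k\<le>degree p. smult (c k) (nb_poly d k))"
    using ex_nb_poly_expansion by blast
  have "poly_mat V (adj_matrix G) (nb_poly d k) u u = km d (poly (nb_poly d k))" if "k \<le> M" for k
    using nb_walks_closed_eq_0[OF u_good, of k] that u_good
    by (cases "k = 0")
      (simp_all add: poly_mat_nb_poly km_nb_poly[OF real_d_gt_2]
        del: nb_poly.simps nb_walks.simps(2))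
  then show ?thesis
    using degree_le
    by (subst (1 2) expansion)
      (simp add: poly_mat_def poly_op_sum km_poly_sum[OF real_d_gt_2] km_poly_smult)
qed

lemma poly_mat_good_row:
  assumes d_gt_2: "2 < d" and u_good: "u \<in> V - bad_vertices V G M" and degree_le: "degree p < M"
  shows "(\<Sum>v\<in>V. adj_matrix G u v * poly_mat V (adj_matrix G) p u v) = km d (poly ([:0, 1:] * p))"
proof -
  have "degree ([:0, 1:] * p) \<le> M"
    using degree_mult_le[of "[:0, 1:]" degree_le] degree_le by simp
  then have "poly_mat V (adj_matrix G) ([:0, 1:] * p) u u = km d (poly ([:0, 1:] * p))"
    by (rule poly_mat_good_diag[OF d_gt_2 u_good])
  moreover have "poly_mat V (adj_matrix G) ([:0, 1:] * p) u u =
      (\<Sum>v\<in>V. poly_mat V (adj_matrix G) [:0, 1:] u v * poly_mat V (adj_matrix G) p u v)"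
    using u_good by (intro adj.poly_mat_mult_diag) simp
  ultimately show ?thesis by (simp add: poly_mat_X finite_V)
qed

lemma inner_nb_walks_good:
  assumes d_gt_2: "2 < d" and u_good: "u \<in> V - bad_vertices V G M" and short: "j + k \<le> M"
  shows "(\<Sum>w\<in>V. real (nb_walks G j {} u w) * real (nb_walks G k {} u w)) =
    km d (poly (nb_poly d j * nb_poly d k))"
proof -
  have "degree (nb_poly d j * nb_poly d k) \<le> M"
    using degree_mult_le[of "nb_poly d j" "nb_poly d k"] short by (simp add: degree_nb_poly)
  from poly_mat_good_diag[OF d_gt_2 u_good this] show ?thesis
    using u_good by (simp add: adj.poly_mat_mult_diag poly_mat_nb_poly)
qed

lemma nb_walks_good_unique_length:
  assumes d_gt_2: "2 < d" and u_good: "u \<in> V - bad_vertices V G M" and v_in: "v \<in> V"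
    and lengths: "j + k \<le> M" "j \<noteq> k" and reached: "nb_walks G j {} u v \<noteq> 0"
  shows "nb_walks G k {} u v = 0"
proof -
  have "(\<Sum>w\<in>V. real (nb_walks G j {} u w) * real (nb_walks G k {} u w)) = 0"
    using inner_nb_walks_good[OF d_gt_2 u_good lengths(1)]
      km_nb_poly_orthogonal[OF _ lengths(2)] d_gt_2
    by simp
  then have "real (nb_walks G j {} u v) * real (nb_walks G k {} u v) = 0"
    using v_in by (subst (asm) sum_nonneg_eq_0_iff) (auto simp: finite_V)
  with reached show ?thesis by simp
qed

lemma nb_walks_good_le_1:
  assumes d_gt_2: "2 < d" and u_good: "u \<in> V - bad_vertices V G M"
    and v_in: "v \<in> V" and short: "2 * k \<le> M"
  shows "nb_walks G k {} u v \<le> 1"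
proof (cases k)
  case (Suc l)
  let ?N = "\<lambda>w. real (nb_walks G k {} u w)"
  have "(\<Sum>w\<in>V. ?N w * ?N w) = real d * (real d - 1) ^ l"
    using inner_nb_walks_good[OF d_gt_2 u_good, of k k]
      km_nb_poly_square[of "real d" l] short d_gt_2 Suc
    by simp
  also have "\<dots> = real (\<Sum>w\<in>V. nb_walks G k {} u w)"
    using sum_nb_walks_Suc[of u l] u_good d_gt_2 unfolding Suc by (simp add: of_nat_diff)
  finally have "(\<Sum>w\<in>V. ?N w * (?N w - 1)) = 0"
    by (simp add: right_diff_distrib sum_subtractf)
  moreover have "0 \<le> real m * (real m - 1)" for m
    by (cases m) auto
  ultimately have "?N v * (?N v - 1) = 0"
    using v_in finite_V by (subst (asm) sum_nonneg_eq_0_iff) auto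
  then show ?thesis by auto
qed simp

text \<open>At a good vertex \<open>u\<close>, the entry \<open>p(A)\<^bsub>uv\<^esub>\<close> is a single coefficient of \<open>p\<close> in the orthogonal
  system of nonbacktracking polynomials, and Bessel's inequality bounds it.\<close>

lemma poly_mat_good_entry_le:
  assumes d_gt_2: "2 < d" and u_good: "u \<in> V - bad_vertices V G M" and v_in: "v \<in> V" "v \<noteq> u"
    and degree_le: "2 * degree p \<le> M"
  shows "\<bar>poly_mat V (adj_matrix G) p u v\<bar> \<le> sqrt (km d (poly (p * p)) / d)"
proof -
  have real_d_gt_2: "real d > 2" using d_gt_2 by simp
  let ?nb = "\<lambda>k. nb_walks G k {} u v" and ?M = "\<lambda>q. poly_mat V (adj_matrix G) q u v"
  obtain c where expansion: "p = (\<Sum>k\<le>degree p. smult (c k) (nb_poly d k))"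
    using ex_nb_poly_expansion by blast
  have "?M p = (\<Sum>k\<le>degree p. c k * ?M (nb_poly d k))"
    by (subst expansion) (simp add: poly_mat_def poly_op_sum)
  then have entry: "?M p = (\<Sum>k\<le>degree p. c k * ?nb k)"
    using u_good v_in by (simp add: poly_mat_nb_poly)
  have sq_nonneg: "0 \<le> km d (poly (p * p))"
    using km_mono[OF real_d_gt_2, of "poly 0" "poly (p * p)"] by (simp add: continuous_intros)
  show ?thesis
  proof (cases "\<forall>k\<le>degree p. ?nb k = 0")
    case True
    then show ?thesis using sq_nonneg by (simp add: entry)
  next
    case False
    then obtain k where k_reached: "k \<le> degree p" "?nb k \<noteq> 0" by blast
    then obtain l where k_eq: "k = Suc l" using v_in(2) by (cases k) auto
    have "?nb k = 1"
      using nb_walks_good_le_1[OF d_gt_2 u_good v_in(1), of k] k_reached degree_le by linarith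
    moreover have "?nb j = 0" if "j \<le> degree p" "j \<noteq> k" for j
      using nb_walks_good_unique_length[OF d_gt_2 u_good v_in(1) _ _ k_reached(2), of j]
        that k_reached(1) degree_le
      by simp
    ultimately have "?M p = (\<Sum>j\<le>degree p. if j = k then c j else 0)"
      unfolding entry by (intro sum.cong) auto
    then have coeff: "?M p = c k" using k_reached(1) by simp
    have "(c k)\<^sup>2 * d \<le> (c k)\<^sup>2 * (d * (real d - 1) ^ l)"
      using real_d_gt_2 by (intro mult_left_mono) (auto simp: one_le_power)
    also have "\<dots> \<le> km d (poly (p * p))"
      using bessel_nb_poly[OF real_d_gt_2 expansion k_reached(1)]
        km_nb_poly_square[OF real_d_gt_2, of l]
      by (simp only: k_eq)
    finally have "(c k)\<^sup>2 \<le> km d (poly (p * p)) / d"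
      using real_d_gt_2 by (simp add: pos_le_divide_eq)
    then show ?thesis
      unfolding coeff using real_le_rsqrt by (metis power2_abs)
  qed
qed

end

section \<open>Counting lollipops by switching\<close>

definition switch :: "'v set set \<Rightarrow> 'v \<Rightarrow> 'v \<Rightarrow> 'v \<Rightarrow> 'v \<Rightarrow> 'v set set" where
  "switch G a b x y = (G - {{a, b}, {x, y}}) \<union> {{a, x}, {b, y}}"

definition switchings :: "'v set set \<Rightarrow> 'v list \<Rightarrow> 'v \<Rightarrow> ('v \<times> 'v) set" where
  "switchings G w b =
    {(x, y). {x, y} \<in> G \<and> x \<notin> set w \<and> y \<noteq> last w \<and> y \<noteq> b \<and> {last w, x} \<notin> G \<and> {b, y} \<notin> G}"

definition switching_traces :: "'v set \<Rightarrow> 'v set set \<Rightarrow> nat \<Rightarrow> (('v list \<times> 'v) \<times> ('v \<times> 'v)) set" where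
  "switching_traces V G m =
    (SIGMA l:(SIGMA w:walks V G m. set w). nbrs G (last (fst l)) \<times> nbrs G (snd l))"

lemma last_walk_in:
  assumes "w \<in> walks V G m"
  shows "last w \<in> V"
proof -
  have "w \<noteq> []" "set w \<subseteq> V" using assms by (auto simp: walks_def)
  then show ?thesis using last_in_set by blast
qed

context regular_graph
begin

lemma finite_G: "finite G"
  using finite_subset[of G "Pow V"] edges finite_V by blast

lemma card_Sigma_nbrs:
  assumes "X \<subseteq> V"
  shows "card (SIGMA x:X. nbrs G x) = card X * d"
proof -
  have "card (SIGMA x:X. nbrs G x) = (\<Sum>x\<in>X. card (nbrs G x))"
    using finite_subset[OF assms finite_V] by simp
  also have "\<dots> = (\<Sum>x\<in>X. d)" using assms by (intro sum.cong refl card_nbrs) auto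
  finally show ?thesis by simp
qed

lemma card_walks: "card (walks V G m) \<le> card V * d ^ m"
proof (induction m)
  case 0
  have "walks V G 0 \<subseteq> (\<lambda>v. [v]) ` V"
    by (auto simp: walks_def length_Suc_conv)
  then show ?case
    using surj_card_le[OF finite_V] by simp
next
  case (Suc m)
  let ?S = "SIGMA w:walks V G m. nbrs G (last w)"
  have "walks V G (Suc m) \<subseteq> (\<lambda>(w, x). w @ [x]) ` ?S"
  proof
    fix w assume w: "w \<in> walks V G (Suc m)"
    then have "w \<noteq> []" by (auto simp: walks_def)
    then obtain w' x where [simp]: "w = w' @ [x]" by (metis rev_exhaust)
    have "w' \<noteq> []" using w by (auto simp: walks_def)
    then have "(w', x) \<in> ?S"
      using w by (auto simp: walks_def successively_append_iff)
    then show "w \<in> (\<lambda>(w, x). w @ [x]) ` ?S"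
      by (rule image_eqI[rotated]) simp
  qed
  then have "card (walks V G (Suc m)) \<le> card ?S"
    by (intro surj_card_le finite_SigmaI finite_walks finite_V) auto
  also have "\<dots> = (\<Sum>w\<in>walks V G m. card (nbrs G (last w)))"
    by (simp add: finite_walks finite_V)
  also have "\<dots> = (\<Sum>w\<in>walks V G m. d)"
    by (intro sum.cong refl card_nbrs last_walk_in)
  also have "\<dots> \<le> card V * d ^ m * d"
    using mult_right_mono[OF Suc.IH, of d] by simp
  finally show ?case by (simp add: mult_ac)
qed

lemma finite_switching_traces: "finite (switching_traces V G m)"
  unfolding switching_traces_def
  by (intro finite_SigmaI finite_walks finite_V finite_cartesian_product) auto

lemma card_switching_traces: "card (switching_traces V G m) \<le> card V * d ^ m * (Suc m * (d * d))"
proof -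
  let ?W = "SIGMA w:walks V G m. set w"
  have finite_W: "finite ?W" by (intro finite_SigmaI finite_walks finite_V) auto
  have "card (switching_traces V G m) = (\<Sum>l\<in>?W. card (nbrs G (last (fst l)) \<times> nbrs G (snd l)))"
    unfolding switching_traces_def using finite_W by (intro card_SigmaI) auto
  also have "\<dots> = (\<Sum>l\<in>?W. d * d)"
  proof (intro sum.cong refl)
    fix l assume "l \<in> ?W"
    then have l: "fst l \<in> walks V G m" "snd l \<in> set (fst l)" by auto
    then have "snd l \<in> V" by (auto simp: walks_def)
    with last_walk_in[OF l(1)] show "card (nbrs G (last (fst l)) \<times> nbrs G (snd l)) = d * d"
      by (simp add: card_cartesian_product card_nbrs)
  qed
  also have "\<dots> = (\<Sum>w\<in>walks V G m. card (set w)) * (d * d)"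
    by (simp add: finite_walks finite_V)
  also have "\<dots> \<le> (\<Sum>w\<in>walks V G m. Suc m) * (d * d)"
    by (intro mult_right_mono sum_mono) (auto simp: walks_def intro: order_trans[OF card_length])
  also have "\<dots> = card (walks V G m) * (Suc m * (d * d))"
    by (simp only: sum_constant of_nat_id mult.assoc)
  also have "\<dots> \<le> card V * d ^ m * (Suc m * (d * d))"
    by (intro mult_right_mono card_walks) simp
  finally show ?thesis .
qed

lemma switch_regular:
  assumes old_edges: "{a, b} \<in> G" "{x, y} \<in> G" and non_edges: "{a, x} \<notin> G" "{b, y} \<notin> G"
    and ends_neq: "x \<noteq> a" "x \<noteq> b" "y \<noteq> a" "y \<noteq> b"
  shows "regular_graph V d (switch G a b x y)"
proof
  let ?G = "switch G a b x y"
  note ab = edgeD[OF old_edges(1)] and xy = edgeD[OF old_edges(2)]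
  show "finite V" by (rule finite_V)
  show "?G \<subseteq> {e. e \<subseteq> V \<and> card e = 2}"
    using edges ab xy ends_neq by (auto simp: switch_def)
  have "{a, b} \<noteq> {x, y}" "{a, x} \<noteq> {b, y}"
    using ab(3) ends_neq by (auto simp only: doubleton_eq_iff)
  moreover have "?G = insert {a, x} (insert {b, y} (G - {{a, b}} - {{x, y}}))"
    unfolding switch_def by blast
  ultimately have sum_switch:
    "(\<Sum>e\<in>?G. g e) + (g {a, b} + g {x, y}) = (\<Sum>e\<in>G. g e) + (g {a, x} + g {b, y})"
    for g :: "'v set \<Rightarrow> nat"
    using old_edges non_edges finite_G
    by (simp add: sum.remove[of G "{a, b}"] sum.remove[of "G - {{a, b}}" "{x, y}"])
  have incident: "of_bool (v \<in> {p, q}) = (of_bool (v = p) + of_bool (v = q) :: nat)"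
    if "p \<noteq> q" for p q v :: 'v
    using that by auto
  have card_incident: "card {e \<in> H. v \<in> e} = (\<Sum>e\<in>H. of_bool (v \<in> e))"
    if "finite H" for H :: "'v set set" and v
    using that by (simp add: of_bool_def sum.If_cases Int_def)
  fix v assume v_in: "v \<in> V"
  have "(\<Sum>e\<in>?G. of_bool (v \<in> e)) = (\<Sum>e\<in>G. of_bool (v \<in> e) :: nat)"
    using sum_switch[of "\<lambda>e. of_bool (v \<in> e)"] incident[OF ab(3)] incident[OF xy(3)]
      incident[of a x] incident[of b y] ends_neq by simp
  moreover have "finite ?G" using finite_G by (simp add: switch_def)
  ultimately show "card {e \<in> ?G. v \<in> e} = d"
    using degree[OF v_in] by (simp only: card_incident finite_G)
qed

lemma finite_switchings: "finite (switchings G w b)"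
  by (rule finite_subset[of _ "V \<times> V"]) (auto simp: switchings_def finite_V dest: edgeD)

lemma card_switchings:
  assumes "(w, b) \<in> lollipops V G m"
  shows "card V * d \<le> card (switchings G w b) + d * (m + 3 + 2 * d)"
proof -
  have "w \<in> walks V G m" and b_in: "b \<in> set w"
    using assms lollipops_subset by fastforce+
  then have last_in: "last w \<in> V" and w_facts: "length w = Suc m" "set w \<subseteq> V"
    by (auto simp: walks_def last_walk_in)
  define X where "X = set w \<union> nbrs G (last w)"
  define Y where "Y = {last w, b} \<union> nbrs G b"
  have XY_subset: "X \<subseteq> V" "Y \<subseteq> V"
    using w_facts b_in last_in nbrs_subset unfolding X_def Y_def by blast+
  have "card X \<le> card (set w) + card (nbrs G (last w))"
    "card Y \<le> card {last w, b} + card (nbrs G b)"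
    unfolding X_def Y_def by (rule card_Un_le)+
  moreover have "card (set w) \<le> Suc m" "card {last w, b} \<le> 2"
    using card_length[of w] w_facts(1) by (simp_all add: card_insert_if)
  ultimately have card_XY: "card X \<le> Suc m + d" "card Y \<le> 2 + d"
    using card_nbrs[OF last_in] card_nbrs[of b] w_facts b_in by auto
  let ?arcs = "\<lambda>X. SIGMA x:X. nbrs G x"
  have finite_arcs: "finite (?arcs X)" if "X \<subseteq> V" for X
    using that by (intro finite_SigmaI finite_subset[OF that finite_V]) auto
  have "?arcs V \<subseteq> switchings G w b \<union> (?arcs X \<union> prod.swap ` ?arcs Y)"
    by (auto simp: switchings_def X_def Y_def image_iff insert_commute)
  then have "card (?arcs V) \<le> card (switchings G w b \<union> (?arcs X \<union> prod.swap ` ?arcs Y))"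
    using XY_subset by (intro card_mono finite_UnI finite_imageI finite_switchings finite_arcs)
  also have "\<dots> \<le> card (switchings G w b) + (card (?arcs X) + card (prod.swap ` ?arcs Y))"
    by (intro order_trans[OF card_Un_le] add_mono order_refl)
  also have "\<dots> \<le> card (switchings G w b) + (card (?arcs X) + card (?arcs Y))"
    using XY_subset by (intro add_mono order_refl card_image_le finite_arcs)
  also have "\<dots> \<le> card (switchings G w b) + ((Suc m + d) * d + (2 + d) * d)"
    unfolding card_Sigma_nbrs[OF XY_subset(1)] card_Sigma_nbrs[OF XY_subset(2)]
    using card_XY by (intro add_mono mult_right_mono order_refl) auto
  finally show ?thesis
    by (simp add: card_Sigma_nbrs algebra_simps)
qed

lemma lollipop_switch:
  assumes lollipop: "(w, b) \<in> lollipops V G m" and switching: "(x, y) \<in> switchings G w b"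
  defines "G' \<equiv> switch G (last w) b x y"
  shows "regular_graph V d G'" "((w, b), (x, y)) \<in> switching_traces V G' m"
    "switch G' (last w) x b y = G"
proof -
  have "butlast w \<noteq> []" "w \<noteq> []" using lollipop by (auto simp: lollipops_def)
  then obtain v c a where w_eq: "w = v @ [c, a]"
    by (metis append_butlast_last_id append.assoc append_Cons append_Nil)
  have path: "successively (\<lambda>u v. {u, v} \<in> G) (v @ [c])" "{c, a} \<in> G" "distinct (v @ [c, a])"
    and closing: "{a, b} \<in> G" "b \<in> set v" and walk: "w \<in> walks V G m"
    using lollipop
    by (auto simp: lollipops_def walks_def w_eq butlast_append successively_append_iff)
  have new_edge: "{x, y} \<in> G" "x \<notin> set (v @ [c, a])" "y \<noteq> a" "y \<noteq> b" "{a, x} \<notin> G" "{b, y} \<notin> G"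
    using switching by (auto simp: switchings_def w_eq)
  have G': "G' = switch G a b x y" by (simp add: G'_def w_eq)
  show "regular_graph V d G'"
    unfolding G' using closing new_edge by (intro switch_regular) auto
  show "switch G' (last w) x b y = G"
    using new_edge closing unfolding G' w_eq switch_def by auto
  have "{c, a} \<in> G'"
    using path closing new_edge by (auto simp: G' switch_def doubleton_eq_iff)
  moreover have "successively (\<lambda>u v. {u, v} \<in> G') (v @ [c])"
    using path(1)
    by (rule successively_mono)
      (use path(3) new_edge(2) in \<open>auto simp: G' switch_def doubleton_eq_iff\<close>)
  ultimately have "w \<in> walks V G' m"
    using walk by (auto simp: w_eq walks_def successively_append_iff)
  then show "((w, b), (x, y)) \<in> switching_traces V G' m"
    using closing(2) by (simp add: switching_traces_def w_eq) (simp add: G' switch_def)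
qed

end

lemma sum_card_mult_le_of_inj_on:
  assumes finite: "finite R" "\<And>r. r \<in> R \<Longrightarrow> finite (L r)" "\<And>r l. r \<in> R \<Longrightarrow> l \<in> L r \<Longrightarrow> finite (S r l)"
      "\<And>r. r \<in> R \<Longrightarrow> finite (T r)"
    and inj: "inj_on F (SIGMA r:R. SIGMA l:L r. S r l)"
    and image: "F ` (SIGMA r:R. SIGMA l:L r. S r l) \<subseteq> (SIGMA r:R. T r)"
    and lower: "\<And>r l. r \<in> R \<Longrightarrow> l \<in> L r \<Longrightarrow> a \<le> card (S r l)"
    and upper: "\<And>r. r \<in> R \<Longrightarrow> card (T r) \<le> b"
  shows "(\<Sum>r\<in>R. card (L r)) * a \<le> card R * b"
proof -
  have "(\<Sum>r\<in>R. card (L r)) * a = (\<Sum>r\<in>R. \<Sum>l\<in>L r. a)"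
    by (simp add: sum_distrib_right)
  also have "\<dots> \<le> (\<Sum>r\<in>R. \<Sum>l\<in>L r. card (S r l))"
    by (intro sum_mono lower)
  also have "\<dots> = card (SIGMA r:R. SIGMA l:L r. S r l)"
    using finite by (simp add: card_SigmaI)
  also have "\<dots> \<le> card (SIGMA r:R. T r)"
    using finite by (intro card_inj_on_le[OF inj image]) auto
  also have "\<dots> = (\<Sum>r\<in>R. card (T r))"
    using finite by (simp add: card_SigmaI)
  also have "\<dots> \<le> card R * b"
    using sum_mono[of R "\<lambda>r. card (T r)" "\<lambda>_. b"] upper by simp
  finally show ?thesis .
qed

lemma finite_Collect_regular_graph:
  assumes "finite V"
  shows "finite {G. regular_graph V d G}"
  by (rule finite_subset[of _ "Pow (Pow V)"]) (use assms in \<open>auto dest: regular_graph.edges\<close>)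

lemma inj_on_lollipop_switch:
  "inj_on (\<lambda>(G, (w, b), (x, y)). (switch G (last w) b x y, (w, b), (x, y)))
    (SIGMA G:{G. regular_graph V d G}. SIGMA l:lollipops V G m. switchings G (fst l) (snd l))"
  by (rule inj_on_inverseI[where
        g = "\<lambda>(G, (w, b), (x, y)). (switch G (last w) x b y, (w, b), (x, y))"])
    (auto simp: regular_graph.lollipop_switch(3))

text \<open>Switching the closing edge of a lollipop with a further edge is an injection from about
  \<open>d |V|\<close> switchings for every lollipop into traces, of which there are only \<open>O(|V|)\<close> in each
  graph.\<close>

lemma sum_card_lollipops_le:
  assumes finite_V: "finite V" and d_pos: "0 < d" and large: "2 * (m + 3 + 2 * d) \<le> card V"
  shows "(\<Sum>G | regular_graph V d G. card (lollipops V G m)) \<le>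
    card {G. regular_graph V d G} * (2 * d ^ Suc m * Suc m)"
proof -
  let ?R = "{G. regular_graph V d G}"
  let ?s = "\<Sum>G\<in>?R. card (lollipops V G m)"
  define a where "a = card V * d - d * (m + 3 + 2 * d)"
  have "2 * (d * (m + 3 + 2 * d)) \<le> card V * d"
    using mult_right_mono[OF large, of d] by (simp add: mult_ac)
  then have a_ge: "card V * d \<le> 2 * a" unfolding a_def by linarith
  have "?s * a \<le> card ?R * (card V * d ^ m * (Suc m * (d * d)))"
  proof (rule sum_card_mult_le_of_inj_on[OF _ _ _ _ inj_on_lollipop_switch])
    show "finite ?R" by (rule finite_Collect_regular_graph[OF finite_V])
    fix G assume "G \<in> ?R"
    then interpret regular_graph V d G by simp
    show "finite (lollipops V G m)" by (rule finite_lollipops[OF finite_V])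
    show "finite (switchings G (fst l) (snd l))" for l by (rule finite_switchings)
    show "finite (switching_traces V G m)" by (rule finite_switching_traces)
    show "card (switching_traces V G m) \<le> card V * d ^ m * (Suc m * (d * d))"
      by (rule card_switching_traces)
    show "a \<le> card (switchings G (fst l) (snd l))" if "l \<in> lollipops V G m" for l
      using card_switchings[of "fst l" "snd l" m] that by (simp add: a_def)
  qed (auto dest: regular_graph.lollipop_switch(1,2))
  then have "2 * (?s * a) \<le> 2 * (card ?R * (card V * d ^ m * (Suc m * (d * d))))"
    by (rule mult_left_mono) simp
  moreover have "?s * (card V * d) \<le> 2 * (?s * a)"
    using mult_left_mono[OF a_ge, of ?s] by (simp add: mult_ac)
  ultimately have "?s * (card V * d) \<le> card ?R * (2 * d ^ Suc m * Suc m) * (card V * d)"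
    by (simp only: power_Suc mult_ac)
  moreover have "card V * d > 0" using d_pos large by simp
  ultimately show ?thesis using mult_le_cancel2 by blast
qed

abbreviation random_regular_graph :: "nat \<Rightarrow> nat \<Rightarrow> nat set set pmf" where
  "random_regular_graph n d \<equiv> pmf_of_set (regular_graphs n d)"

abbreviation feasible_sizes :: "nat \<Rightarrow> nat filter" where
  "feasible_sizes d \<equiv> inf sequentially (principal {n. even (d * n)})"

definition bad_vertex_bound :: "nat \<Rightarrow> nat \<Rightarrow> nat" where
  "bad_vertex_bound d M = (\<Sum>m\<le>M. 2 * d ^ Suc m * Suc m)"

lemma sum_card_bad_vertices_le:
  assumes finite_V: "finite V" and d_pos: "0 < d" and large: "2 * (M + 3 + 2 * d) \<le> card V"
  shows "(\<Sum>G | regular_graph V d G. card (bad_vertices V G M)) \<le>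
    card {G. regular_graph V d G} * bad_vertex_bound d M"
proof -
  let ?R = "{G. regular_graph V d G}"
  have "(\<Sum>G\<in>?R. card (bad_vertices V G M)) \<le> (\<Sum>G\<in>?R. \<Sum>m\<le>M. card (lollipops V G m))"
    by (intro sum_mono card_bad_vertices_le finite_V)
  also have "\<dots> = (\<Sum>m\<le>M. \<Sum>G\<in>?R. card (lollipops V G m))"
    by (rule sum.swap)
  also have "\<dots> \<le> (\<Sum>m\<le>M. card ?R * (2 * d ^ Suc m * Suc m))"
    using large by (intro sum_mono sum_card_lollipops_le finite_V d_pos) auto
  finally show ?thesis
    unfolding bad_vertex_bound_def sum_distrib_left .
qed

lemma prob_many_bad_vertices_le:
  assumes d_pos: "0 < d" and large: "2 * (M + 3 + 2 * d) \<le> n"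
    and even: "even (d * n)" and t_pos: "0 < t"
  shows "measure_pmf.prob (random_regular_graph n d)
    {G. t \<le> real (card (bad_vertices {..<n} G M))} \<le> bad_vertex_bound d M / t"
proof -
  let ?R = "regular_graphs n d" and ?f = "\<lambda>G. real (card (bad_vertices {..<n} G M))"
  let ?\<mu> = "random_regular_graph n d"
  have nonempty: "?R \<noteq> {}" using large even by (intro regular_graphs_nonempty) auto
  have finite_R: "finite ?R"
    unfolding regular_graphs_eq by (rule finite_Collect_regular_graph) simp
  have card_R: "0 < card ?R" using nonempty finite_R by (simp add: card_gt_0_iff)
  have "(\<Sum>G\<in>?R. card (bad_vertices {..<n} G M)) \<le> card ?R * bad_vertex_bound d M"
    unfolding regular_graphs_eq using d_pos large by (intro sum_card_bad_vertices_le) auto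
  then have total: "sum ?f ?R \<le> real (card ?R) * bad_vertex_bound d M"
    by (metis of_nat_le_iff of_nat_mult of_nat_sum)
  have "measure_pmf.expectation ?\<mu> ?f = sum ?f ?R / card ?R"
    by (rule integral_pmf_of_set[OF nonempty finite_R])
  also have "\<dots> \<le> bad_vertex_bound d M"
    using total card_R by (simp add: divide_le_eq mult.commute)
  finally have mean: "measure_pmf.expectation ?\<mu> ?f \<le> bad_vertex_bound d M" .
  have "measure_pmf.prob ?\<mu> {G. t \<le> ?f G} \<le> 1 / t * measure_pmf.expectation ?\<mu> ?f"
    using integral_Markov_inequality_measure[of "measure_pmf ?\<mu>" ?f UNIV t] t_pos nonempty finite_R
    by (simp add: integrable_measure_pmf_finite)
  also have "\<dots> \<le> bad_vertex_bound d M / t"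
    using mean t_pos by (simp add: divide_right_mono)
  finally show ?thesis .
qed

lemma const_over_sqrt_tendsto_0: "((\<lambda>n. c / sqrt (real n)) \<longlongrightarrow> 0) sequentially"
  by (intro real_tendsto_divide_at_top[OF tendsto_const]
      filterlim_compose[OF sqrt_at_top filterlim_real_sequentially])

lemma prob_few_bad_vertices_tendsto_1:
  assumes "0 < d"
  shows "((\<lambda>n. measure_pmf.prob (random_regular_graph n d)
    {G. real (card (bad_vertices {..<n} G M)) < sqrt n}) \<longlongrightarrow> 1) (feasible_sizes d)"
proof (rule tendsto_sandwich[where h = "\<lambda>_. 1"])
  let ?prob = "\<lambda>n. measure_pmf.prob (random_regular_graph n d)"
  let ?bad = "\<lambda>n G. real (card (bad_vertices {..<n :: nat} G M))"
  have "1 - bad_vertex_bound d M / sqrt n \<le> ?prob n {G. ?bad n G < sqrt n}"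
    if n_large: "2 * (M + 3 + 2 * d) \<le> n" "even (d * n)" for n
  proof -
    have "?prob n {G. ?bad n G < sqrt n} = 1 - ?prob n {G. sqrt n \<le> ?bad n G}"
      by (subst measure_pmf.prob_compl[symmetric]) (auto intro: arg_cong2[where f = measure])
    moreover have "0 < sqrt n" using n_large(1) by simp
    ultimately show ?thesis
      using prob_many_bad_vertices_le[OF assms n_large] by simp
  qed
  then show "\<forall>\<^sub>F n in feasible_sizes d.
      1 - bad_vertex_bound d M / sqrt n \<le> ?prob n {G. ?bad n G < sqrt n}"
    unfolding eventually_inf_principal
    by (intro eventually_sequentiallyI[of "2 * (M + 3 + 2 * d)"]) auto
  have "((\<lambda>n. 1 - bad_vertex_bound d M / sqrt (real n)) \<longlongrightarrow> 1 - 0) sequentially"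
    by (intro tendsto_diff tendsto_const const_over_sqrt_tendsto_0)
  then show "((\<lambda>n. 1 - bad_vertex_bound d M / sqrt (real n)) \<longlongrightarrow> 1) (feasible_sizes d)"
    using tendsto_mono[OF inf_le1] by force
qed simp_all

section \<open>Pseudoexpectations from Gram matrices\<close>

lemma small_subsets_eq:
  assumes "finite V"
  shows "small_subsets V = insert {} ((\<lambda>v. {v}) ` V)"
proof (intro set_eqI iffI)
  fix S assume "S \<in> small_subsets V"
  then have S: "S \<subseteq> V" "card S = 0 \<or> card S = 1" by (auto simp: small_subsets_def)
  have "finite S" using S(1) assms by (rule finite_subset)
  then show "S \<in> insert {} ((\<lambda>v. {v}) ` V)"
    using S by (auto simp: card_1_singleton_iff)
qed (auto simp: small_subsets_def)

lemma sum_small_subsets: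
  assumes "finite V"
  shows "(\<Sum>S\<in>small_subsets V. f S) = f {} + (\<Sum>v\<in>V. f {v})"
  unfolding small_subsets_eq[OF assms] using assms
  by (subst sum.insert) (auto simp: sum.reindex inj_on_def)

definition moment_functional :: "'v set \<Rightarrow> ('v set \<Rightarrow> real) \<Rightarrow> 'v mlpoly \<Rightarrow> real" where
  "moment_functional V \<mu> r = (\<Sum>U\<in>Pow V. \<mu> U * r U)"

lemma moment_functional_monom:
  assumes "finite V" "U \<subseteq> V"
  shows "moment_functional V \<mu> (mlmonom U) = \<mu> U"
  using assms
  by (simp add: moment_functional_def mlmonom_def if_distrib[of "\<lambda>x. _ * x"] cong: if_cong)

lemma moment_functional_mlmult:
  assumes "finite V"
  shows "moment_functional V \<mu> (mlmult V p q) = (\<Sum>S\<in>Pow V. \<Sum>T\<in>Pow V. p S * q T * \<mu> (sym_diff S T))"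
proof -
  let ?P = "Pow V"
  let ?t = "\<lambda>U S T. if sym_diff S T = U then p S * q T * \<mu> U else 0"
  have "moment_functional V \<mu> (mlmult V p q) = (\<Sum>U\<in>?P. \<Sum>S\<in>?P. \<Sum>T\<in>?P. ?t U S T)"
    unfolding moment_functional_def mlmult_def sum_distrib_left
    by (intro sum.cong refl) (simp add: mult_ac)
  also have "\<dots> = (\<Sum>S\<in>?P. \<Sum>U\<in>?P. \<Sum>T\<in>?P. ?t U S T)"
    by (rule sum.swap)
  also have "\<dots> = (\<Sum>S\<in>?P. \<Sum>T\<in>?P. \<Sum>U\<in>?P. ?t U S T)"
    by (intro sum.cong refl sum.swap)
  also have "\<dots> = (\<Sum>S\<in>?P. \<Sum>T\<in>?P. p S * q T * \<mu> (sym_diff S T))"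
    using assms by (intro sum.cong refl) (subst sum.delta', auto)
  finally show ?thesis .
qed

lemma moment_functional_mlmult_monom:
  assumes "finite V" "S \<subseteq> V" "T \<subseteq> V"
  shows "moment_functional V \<mu> (mlmult V (mlmonom S) (mlmonom T)) = \<mu> (sym_diff S T)"
proof -
  let ?P = "Pow V"
  have "moment_functional V \<mu> (mlmult V (mlmonom S) (mlmonom T)) =
      (\<Sum>S'\<in>?P. if S' = S then (\<Sum>T'\<in>?P. if T' = T then \<mu> (sym_diff S' T') else 0) else 0)"
    unfolding moment_functional_mlmult[OF assms(1)] mlmonom_def
    by (intro sum.cong refl) (auto intro!: sum.cong)
  then show ?thesis using assms by simp
qed

lemma moment_functional_quad_poly:
  assumes "finite V"
  shows "moment_functional V \<mu> (quad_poly V B) = (\<Sum>u\<in>V. \<Sum>v\<in>V. B u v * \<mu> (sym_diff {u} {v}))"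
proof -
  let ?P = "Pow V" and ?m = "\<lambda>u v. mlmult V (mlmonom {u}) (mlmonom {v})"
  have "moment_functional V \<mu> (quad_poly V B) =
      (\<Sum>U\<in>?P. \<Sum>u\<in>V. \<Sum>v\<in>V. B u v * (\<mu> U * ?m u v U))"
    unfolding moment_functional_def quad_poly_def sum_distrib_left by (simp add: mult_ac)
  also have "\<dots> = (\<Sum>u\<in>V. \<Sum>U\<in>?P. \<Sum>v\<in>V. B u v * (\<mu> U * ?m u v U))"
    by (rule sum.swap)
  also have "\<dots> = (\<Sum>u\<in>V. \<Sum>v\<in>V. \<Sum>U\<in>?P. B u v * (\<mu> U * ?m u v U))"
    by (intro sum.cong refl sum.swap)
  also have "\<dots> = (\<Sum>u\<in>V. \<Sum>v\<in>V. B u v * moment_functional V \<mu> (?m u v))"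
    unfolding moment_functional_def sum_distrib_left ..
  finally show ?thesis
    using assms by (simp add: moment_functional_mlmult_monom)
qed

definition gram_moment :: "('v \<Rightarrow> 'v \<Rightarrow> real) \<Rightarrow> 'v set \<Rightarrow> real" where
  "gram_moment X U =
    (if U = {} then 1 else if card U = 2 then (\<Sum>u\<in>U. \<Sum>v\<in>U - {u}. X u v) / 2 else 0)"

definition moment_bounded :: "'v set \<Rightarrow> real \<Rightarrow> real \<Rightarrow> ('v mlpoly \<Rightarrow> real) \<Rightarrow> bool" where
  "moment_bounded V g b E \<longleftrightarrow>
    (\<forall>S\<in>small_subsets V. L2_set (pseudomoment_matrix E S) (small_subsets V) \<le> g) \<and>
    spectral_norm (small_subsets V) (pseudomoment_matrix E) \<le> g \<and>
    (\<forall>S\<in>small_subsets V. \<forall>T\<in>small_subsets V. S \<noteq> T \<longrightarrow> \<bar>pseudomoment_matrix E S T\<bar> \<le> b)"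

locale gram_matrix = symmetric_matrix V X for V :: "'v set" and X +
  assumes unit_diag: "u \<in> V \<Longrightarrow> X u u = 1"
    and psd: "psd_on V X"
begin

abbreviation "E \<equiv> moment_functional V (gram_moment X)"

lemma gram_moment_pair:
  assumes "u \<in> V" "v \<in> V"
  shows "gram_moment X (sym_diff {u} {v}) = X u v"
proof (cases "u = v")
  case False
  then have "sym_diff {u} {v} = {u, v}" "{u, v} - {u} = {v}" "{u, v} - {v} = {u}" by auto
  then show ?thesis
    using False sym[OF assms] by (simp add: gram_moment_def)
qed (use unit_diag assms in \<open>simp add: gram_moment_def\<close>)

lemma gram_moment_singleton: "gram_moment X {v} = 0"
  by (simp add: gram_moment_def)

lemma pseudomoment_matrix_simps:
  "pseudomoment_matrix E {} {} = 1"
  "v \<in> V \<Longrightarrow> pseudomoment_matrix E {} {v} = 0"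
  "v \<in> V \<Longrightarrow> pseudomoment_matrix E {v} {} = 0"
  "u \<in> V \<Longrightarrow> v \<in> V \<Longrightarrow> pseudomoment_matrix E {u} {v} = X u v"
proof -
  show "pseudomoment_matrix E {} {} = 1"
    by (simp add: pseudomoment_matrix_def moment_functional_monom finite_index gram_moment_def)
  show "v \<in> V \<Longrightarrow> pseudomoment_matrix E {} {v} = 0" "v \<in> V \<Longrightarrow> pseudomoment_matrix E {v} {} = 0"
    by (simp_all add: pseudomoment_matrix_def moment_functional_monom finite_index
        gram_moment_singleton)
  assume uv: "u \<in> V" "v \<in> V"
  then have "sym_diff {u} {v} \<subseteq> V" by auto
  then show "pseudomoment_matrix E {u} {v} = X u v"
    unfolding pseudomoment_matrix_def
    by (simp only: moment_functional_monom[OF finite_index] gram_moment_pair[OF uv])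
qed

lemma square_nonneg:
  assumes p_linear: "p \<in> mlpolys V 1"
  shows "0 \<le> E (mlmult V p p)"
proof -
  let ?s = "small_subsets V" and ?k = "\<lambda>S T. gram_moment X (sym_diff S T)"
  have p0: "p S = 0" if "S \<in> Pow V - ?s" for S
    using p_linear that by (auto simp: mlpolys_def small_subsets_def)
  have small_subset_Pow: "?s \<subseteq> Pow V" by (auto simp: small_subsets_def)
  have "E (mlmult V p p) = (\<Sum>S\<in>?s. \<Sum>T\<in>Pow V. p S * p T * ?k S T)"
    unfolding moment_functional_mlmult[OF finite_index] using finite_index
    by (intro sum.mono_neutral_right small_subset_Pow) (auto simp: p0)
  also have "\<dots> = (\<Sum>S\<in>?s. \<Sum>T\<in>?s. p S * p T * ?k S T)"
    using finite_index
    by (intro sum.cong refl sum.mono_neutral_right small_subset_Pow) (auto simp: p0)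
  also have "\<dots> = (p {})\<^sup>2 + (\<Sum>u\<in>V. \<Sum>v\<in>V. p {u} * p {v} * ?k {u} {v})"
    unfolding sum_small_subsets[OF finite_index]
    by (simp add: gram_moment_singleton power2_eq_square) (simp add: gram_moment_def)
  also have "(\<Sum>u\<in>V. \<Sum>v\<in>V. p {u} * p {v} * ?k {u} {v}) = (\<Sum>u\<in>V. \<Sum>v\<in>V. p {u} * p {v} * X u v)"
    by (intro sum.cong refl arg_cong2[where f = times] gram_moment_pair)
  also have "\<dots> = inner_on V (\<lambda>u. p {u}) (matvec V X (\<lambda>u. p {u}))"
    by (simp add: inner_on_def matvec_def sum_distrib_left mult_ac)
  finally show ?thesis
    using psd by (simp add: psd_on_def)
qed

lemma pseudoexpectation: "pseudoexpectation2 V E"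
  unfolding pseudoexpectation2_def
proof (intro conjI ballI allI)
  fix p q :: "'v mlpoly" and c
  show "E (\<lambda>S. p S + q S) = E p + E q"
    by (simp add: moment_functional_def distrib_left sum.distrib)
  show "E (\<lambda>S. c * p S) = c * E p"
    by (simp add: moment_functional_def sum_distrib_left mult_ac)
next
  show "E (mlmonom {}) = 1"
    by (simp add: moment_functional_monom finite_index gram_moment_def)
  show "E (mlmult V (mlmonom {v}) (mlmonom {v})) = 1" if "v \<in> V" for v
    using that by (simp add: moment_functional_mlmult_monom finite_index gram_moment_def)
qed (rule square_nonneg)

lemma quad_poly_eq: "E (quad_poly V B) = (\<Sum>u\<in>V. \<Sum>v\<in>V. B u v * X u v)"
  unfolding moment_functional_quad_poly[OF finite_index]
  by (intro sum.cong refl arg_cong2[where f = times] gram_moment_pair)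

lemma l2_bounded_pseudomoment_matrix:
  assumes "1 \<le> g" "l2_bounded V X g"
  shows "l2_bounded (small_subsets V) (pseudomoment_matrix E) g"
proof -
  let ?s = "small_subsets V" and ?M = "pseudomoment_matrix E"
  have g_ge: "0 \<le> g" "1 \<le> g\<^sup>2" using assms(1) by (auto simp: one_le_power)
  have "inner_on ?s (matvec ?s ?M f) (matvec ?s ?M f) \<le> g\<^sup>2 * inner_on ?s f f" for f
  proof -
    let ?f = "\<lambda>v. f {v}"
    have "inner_on ?s (matvec ?s ?M f) (matvec ?s ?M f) =
        f {} * f {} + inner_on V (matvec V X ?f) (matvec V X ?f)"
      by (simp add: inner_on_def matvec_def sum_small_subsets finite_index
          pseudomoment_matrix_simps)
    also have "\<dots> \<le> g\<^sup>2 * (f {} * f {}) + g\<^sup>2 * inner_on V ?f ?f"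
      using assms(2) mult_right_mono[OF g_ge(2), of "f {} * f {}"] g_ge(1)
      by (intro add_mono) (simp_all add: l2_bounded_iff)
    also have "\<dots> = g\<^sup>2 * inner_on ?s f f"
      by (simp add: inner_on_def sum_small_subsets finite_index distrib_left)
    finally show ?thesis .
  qed
  then show ?thesis by (simp add: l2_bounded_iff g_ge(1))
qed

lemma moment_bounded_gram:
  assumes bound: "1 \<le> g" "l2_bounded V X g"
    and entry: "0 \<le> b" "\<And>u v. u \<in> V \<Longrightarrow> v \<in> V \<Longrightarrow> u \<noteq> v \<Longrightarrow> \<bar>X u v\<bar> \<le> b"
  shows "moment_bounded V g b E"
  unfolding moment_bounded_def
proof (intro conjI ballI impI)
  note bounded = l2_bounded_pseudomoment_matrix[OF bound]
  show "spectral_norm (small_subsets V) (pseudomoment_matrix E) \<le> g"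
    using bounded bound(1) by (intro l2_bounded_imp_spectral_norm_le) auto
  have "symmetric_matrix (small_subsets V) (pseudomoment_matrix E)"
    by unfold_locales
      (simp_all add: small_subsets_eq finite_index pseudomoment_matrix_def Un_commute)
  then show "L2_set (pseudomoment_matrix E S) (small_subsets V) \<le> g" if "S \<in> small_subsets V" for S
    using bounded that by (rule symmetric_matrix.l2_bounded_imp_row_le)
  show "\<bar>pseudomoment_matrix E S T\<bar> \<le> b"
    if "S \<in> small_subsets V" "T \<in> small_subsets V" "S \<noteq> T" for S T
    using that entry unfolding small_subsets_eq[OF finite_index]
    by (auto simp: pseudomoment_matrix_simps)
qed

end

section \<open>Isolating exceptional indices\<close>

definition isolate :: "'i set \<Rightarrow> ('i \<Rightarrow> 'i \<Rightarrow> real) \<Rightarrow> 'i \<Rightarrow> 'i \<Rightarrow> real" where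
  "isolate B M u v = (if u = v then 1 else if u \<in> B \<or> v \<in> B then 0 else M u v)"

definition zero_on :: "'i set \<Rightarrow> ('i \<Rightarrow> real) \<Rightarrow> 'i \<Rightarrow> real" where
  "zero_on B f u = (if u \<in> B then 0 else f u)"

context
  fixes I B :: "'i set" and M :: "'i \<Rightarrow> 'i \<Rightarrow> real"
  assumes finite_I: "finite I" and diag: "\<And>u. u \<in> I - B \<Longrightarrow> M u u = 1"
begin

lemma matvec_isolate:
  assumes "u \<in> I"
  shows "matvec I (isolate B M) f u = (if u \<in> B then f u else matvec I M (zero_on B f) u)"
proof (cases "u \<in> B")
  case True
  then have "matvec I (isolate B M) f u = (\<Sum>v\<in>I. if u = v then f v else 0)"
    unfolding matvec_def by (intro sum.cong refl) (simp add: isolate_def)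
  then show ?thesis using True assms finite_I by simp
next
  case False
  then show ?thesis
    using assms diag unfolding matvec_def by (auto intro!: sum.cong simp: isolate_def zero_on_def)
qed

lemma psd_on_isolate:
  assumes "psd_on I M"
  shows "psd_on I (isolate B M)"
proof -
  have "0 \<le> inner_on I f (matvec I (isolate B M) f)" for f
  proof -
    let ?m = "zero_on B f"
    have "inner_on I f (matvec I (isolate B M) f) =
        (\<Sum>u\<in>I. (if u \<in> B then f u * f u else 0) + ?m u * matvec I M ?m u)"
      unfolding inner_on_def by (intro sum.cong refl) (simp add: matvec_isolate zero_on_def)
    also have "\<dots> = (\<Sum>u\<in>I. if u \<in> B then f u * f u else 0) + inner_on I ?m (matvec I M ?m)"
      by (simp add: sum.distrib inner_on_def)
    also have "\<dots> \<ge> 0"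
      using assms by (intro add_nonneg_nonneg sum_nonneg) (auto simp: psd_on_def)
    finally show ?thesis .
  qed
  then show ?thesis by (simp add: psd_on_def)
qed

lemma l2_bounded_isolate:
  assumes "1 \<le> g" "l2_bounded I M g"
  shows "l2_bounded I (isolate B M) g"
proof -
  have g_ge: "0 \<le> g" "1 \<le> g\<^sup>2" using assms(1) by (auto simp: one_le_power)
  let ?X = "matvec I (isolate B M)"
  have "inner_on I (?X f) (?X f) \<le> g\<^sup>2 * inner_on I f f" for f
  proof -
    let ?m = "zero_on B f" and ?b = "\<Sum>u\<in>I. if u \<in> B then f u * f u else 0"
    have "inner_on I (?X f) (?X f) \<le>
        (\<Sum>u\<in>I. (if u \<in> B then f u * f u else 0) + matvec I M ?m u * matvec I M ?m u)"
      unfolding inner_on_def by (intro sum_mono) (simp add: matvec_isolate)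
    also have "\<dots> = 1 * ?b + inner_on I (matvec I M ?m) (matvec I M ?m)"
      by (simp add: sum.distrib inner_on_def)
    also have "\<dots> \<le> g\<^sup>2 * ?b + g\<^sup>2 * inner_on I ?m ?m"
    proof (rule add_mono)
      show "1 * ?b \<le> g\<^sup>2 * ?b" by (intro mult_right_mono g_ge sum_nonneg) auto
      show "inner_on I (matvec I M ?m) (matvec I M ?m) \<le> g\<^sup>2 * inner_on I ?m ?m"
        using assms(2) by (simp add: l2_bounded_iff g_ge(1))
    qed
    also have "\<dots> = g\<^sup>2 * inner_on I f f"
      unfolding inner_on_def distrib_left[symmetric] sum.distrib[symmetric]
      by (intro arg_cong2[where f = times] sum.cong refl) (simp add: zero_on_def)
    finally show ?thesis .
  qed
  then show ?thesis by (simp add: l2_bounded_iff g_ge(1))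
qed

end

section \<open>The pseudoexpectation of a random regular graph\<close>

definition certified_graphs :: "'v set \<Rightarrow> real \<Rightarrow> real \<Rightarrow> real \<Rightarrow> 'v set set set" where
  "certified_graphs V g b s = {G. \<exists>E. pseudoexpectation2 V E \<and>
    s \<le> E (quad_poly V (\<lambda>u v. - adj_matrix G u v)) \<and> moment_bounded V g b E}"

context regular_graph
begin

lemma isolate_row_ge:
  fixes s g :: real
  assumes B_subset: "B \<subseteq> V" and u_in: "u \<in> V - B"
    and row: "(\<Sum>v\<in>V. adj_matrix G u v * M u v) \<le> - s"
    and entry: "\<And>v. v \<in> B \<Longrightarrow> \<bar>M u v\<bar> \<le> g"
  shows "s - g * (\<Sum>v\<in>B. adj_matrix G u v) \<le> (\<Sum>v\<in>V. - adj_matrix G u v * isolate B M u v)"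
proof -
  let ?A = "adj_matrix G"
  have "(\<Sum>v\<in>B. ?A u v * M u v) \<ge> (\<Sum>v\<in>B. ?A u v * - g)"
    using entry
    by (intro sum_mono mult_left_mono adj_matrix_nonneg) (simp add: abs_le_iff minus_le_iff)
  moreover have "(\<Sum>v\<in>V. ?A u v * M u v) = (\<Sum>v\<in>V - B. ?A u v * M u v) + (\<Sum>v\<in>B. ?A u v * M u v)"
    by (rule sum.subset_diff[OF B_subset finite_V])
  moreover have "(\<Sum>v\<in>V. - ?A u v * isolate B M u v) = (\<Sum>v\<in>V - B. - ?A u v * M u v)"
    using u_in edgeD(3)[of u u]
    by (intro sum.mono_neutral_cong_right finite_V) (auto simp: isolate_def adj_matrix_def)
  ultimately show ?thesis
    using row by (simp add: sum_negf sum_distrib_left mult.commute)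
qed

lemma isolate_objective_ge:
  fixes s g :: real
  assumes B_subset: "B \<subseteq> V" and g_nonneg: "0 \<le> g"
    and row: "\<And>u. u \<in> V - B \<Longrightarrow> (\<Sum>v\<in>V. adj_matrix G u v * M u v) \<le> - s"
    and entry: "\<And>u v. u \<in> V - B \<Longrightarrow> v \<in> B \<Longrightarrow> \<bar>M u v\<bar> \<le> g"
  shows "s * card V - (s + d * g) * card B \<le> (\<Sum>u\<in>V. \<Sum>v\<in>V. - adj_matrix G u v * isolate B M u v)"
proof -
  let ?A = "adj_matrix G"
  have "(\<Sum>u\<in>V - B. \<Sum>v\<in>B. ?A u v) \<le> (\<Sum>u\<in>V. \<Sum>v\<in>B. ?A u v)"
    by (intro sum_mono2 finite_V sum_nonneg adj_matrix_nonneg) auto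
  also have "\<dots> = (\<Sum>v\<in>B. \<Sum>u\<in>V. ?A v u)"
    by (subst sum.swap) (simp only: adj_matrix_commute)
  also have "\<dots> = d * card B"
    using B_subset by (simp add: sum_adj subset_iff)
  finally have cut: "(\<Sum>u\<in>V - B. \<Sum>v\<in>B. ?A u v) \<le> d * card B" .
  have "real (card V) = card (V - B) + card B"
    using B_subset finite_V by (simp add: card_Diff_subset finite_subset card_mono of_nat_diff)
  then have "s * card V - (s + d * g) * card B = s * card (V - B) - g * (d * card B)"
    by (simp only:) (simp add: algebra_simps)
  also have "\<dots> \<le> s * card (V - B) - g * (\<Sum>u\<in>V - B. \<Sum>v\<in>B. ?A u v)"
    using cut g_nonneg by (simp add: mult_left_mono)
  also have "\<dots> = (\<Sum>u\<in>V - B. s - g * (\<Sum>v\<in>B. ?A u v))"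
    by (simp add: sum_subtractf sum_distrib_left)
  also have "\<dots> \<le> (\<Sum>u\<in>V - B. \<Sum>v\<in>V. - ?A u v * isolate B M u v)"
    by (intro sum_mono isolate_row_ge B_subset row entry)
  also have "\<dots> = (\<Sum>u\<in>V. \<Sum>v\<in>V. - ?A u v * isolate B M u v)"
  proof (intro sum.mono_neutral_left finite_V ballI)
    fix u assume "u \<in> V - (V - B)"
    then show "(\<Sum>v\<in>V. - ?A u v * isolate B M u v) = 0"
      using edgeD(3)[of u u] by (intro sum.neutral) (auto simp: isolate_def adj_matrix_def)
  qed auto
  finally show ?thesis .
qed

lemma in_certified_graphs_isolate:
  fixes s \<gamma> b :: real
  assumes M: "symmetric_matrix V M" "psd_on V M" "l2_bounded V M \<gamma>"
    and \<gamma>: "1 \<le> \<gamma>" and b_nonneg: "0 \<le> b"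
    and B_subset: "B \<subseteq> V" and diag: "\<And>u. u \<in> V - B \<Longrightarrow> M u u = 1"
    and row: "\<And>u. u \<in> V - B \<Longrightarrow> (\<Sum>v\<in>V. adj_matrix G u v * M u v) \<le> - s"
    and entry: "\<And>u v. u \<in> V - B \<Longrightarrow> v \<in> V \<Longrightarrow> u \<noteq> v \<Longrightarrow> \<bar>M u v\<bar> \<le> b"
  shows "G \<in> certified_graphs V \<gamma> b (s * card V - (s + d * b) * card B)"
proof -
  interpret M: symmetric_matrix V M by (rule M)
  interpret X: gram_matrix V "isolate B M"
  proof
    show "isolate B M u v = isolate B M v u" if "u \<in> V" "v \<in> V" for u v
      using M.sym[OF that] by (simp add: isolate_def)
    show "psd_on V (isolate B M)"
      using finite_V diag M(2) by (rule psd_on_isolate)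
  qed (simp_all add: isolate_def finite_V)
  have "moment_bounded V \<gamma> b X.E"
  proof (rule X.moment_bounded_gram[OF \<gamma> _ b_nonneg])
    show "l2_bounded V (isolate B M) \<gamma>"
      using finite_V diag \<gamma> M(3) by (rule l2_bounded_isolate)
    show "\<bar>isolate B M u v\<bar> \<le> b" if "u \<in> V" "v \<in> V" "u \<noteq> v" for u v
      using entry[of u v] that b_nonneg by (simp add: isolate_def)
  qed
  moreover have "s * card V - (s + d * b) * card B \<le> X.E (quad_poly V (\<lambda>u v. - adj_matrix G u v))"
    unfolding X.quad_poly_eq using B_subset by (intro isolate_objective_ge b_nonneg row entry) auto
  ultimately show ?thesis
    using X.pseudoexpectation unfolding certified_graphs_def by blast
qed

lemma in_certified_graphs:
  fixes s :: real
  assumes d_gt_2: "2 < d" and test: "test_polynomial d \<gamma> s p"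
  shows "G \<in> certified_graphs V \<gamma> (\<gamma> / sqrt d)
    (s * card V - (s + d * (\<gamma> / sqrt d)) * card (bad_vertices V G (2 * degree p + 1)))"
proof -
  let ?M = "poly_mat V (adj_matrix G) p" and ?B = "bad_vertices V G (2 * degree p + 1)"
  have real_d_gt_2: "real d > 2" using d_gt_2 by simp
  have p_facts: "p \<in> bernstein_cone (- real d) d" "[:\<gamma>:] - p \<in> bernstein_cone (- real d) d"
    "km d (poly p) = 1" "km d (poly ([:0, 1:] * p)) \<le> - s"
    using test by (simp_all add: test_polynomial_def)
  note \<gamma> = test_polynomial_bounds[OF real_d_gt_2 test]
  interpret adj: bounded_symmetric_matrix V "adj_matrix G" "- real d" "real d"
    using d_gt_2 by (intro bounded_symmetric_adj) simp
  show ?thesis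
  proof (rule in_certified_graphs_isolate[OF _ _ _ \<gamma>(1) _ bad_vertices_subset])
    show "symmetric_matrix V ?M" by (rule adj.symmetric_matrix_poly_mat)
    show "psd_on V ?M" by (intro adj.psd_on_poly_mat adj.psd_poly_bernstein_cone p_facts)
    show "l2_bounded V ?M \<gamma>" using \<gamma>(1) p_facts by (intro adj.l2_bounded_bernstein_cone) auto
    show "0 \<le> \<gamma> / sqrt d" using \<gamma>(1) by simp
    fix u assume u_good: "u \<in> V - ?B"
    show "?M u u = 1" using poly_mat_good_diag[OF d_gt_2 u_good] p_facts(3) by simp
    show "(\<Sum>v\<in>V. adj_matrix G u v * ?M u v) \<le> - s"
      using poly_mat_good_row[OF d_gt_2 u_good] p_facts(4) by simp
    fix v assume "v \<in> V" "u \<noteq> v"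
    then have "\<bar>?M u v\<bar> \<le> sqrt (km d (poly (p * p)) / d)"
      by (intro poly_mat_good_entry_le[OF d_gt_2 u_good]) auto
    also have "\<dots> \<le> sqrt (\<gamma>\<^sup>2 / d)" using \<gamma>(2) by (simp add: divide_right_mono)
    finally show "\<bar>?M u v\<bar> \<le> \<gamma> / sqrt d" using \<gamma>(1) by (simp add: real_sqrt_divide)
  qed
qed

end

lemma certified_graphs_mono: "s \<le> t \<Longrightarrow> certified_graphs V g b t \<subseteq> certified_graphs V g b s"
  unfolding certified_graphs_def by (blast intro: order_trans)

lemma prob_certified_graphs_tendsto_1:
  fixes d :: nat and s r :: real
  assumes d_gt_2: "2 < d" and test: "test_polynomial d \<gamma> s p"
    and loss: "s + d * (\<gamma> / sqrt d) \<le> r" "0 \<le> r"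
  shows "((\<lambda>n. measure_pmf.prob (random_regular_graph n d)
    (certified_graphs {..<n} \<gamma> (\<gamma> / sqrt d) (s * n - r * sqrt n))) \<longlongrightarrow> 1) (feasible_sizes d)"
proof (rule tendsto_sandwich[where h = "\<lambda>_. 1"])
  let ?bad = "\<lambda>n G. real (card (bad_vertices {..<n :: nat} G (2 * degree p + 1)))"
  let ?cert = "\<lambda>n. certified_graphs {..<n :: nat} \<gamma> (\<gamma> / sqrt d) (s * n - r * sqrt n)"
  let ?prob = "\<lambda>n. measure_pmf.prob (random_regular_graph n d)"
  show "((\<lambda>n. ?prob n {G. ?bad n G < sqrt n}) \<longlongrightarrow> 1) (feasible_sizes d)"
    using d_gt_2 by (intro prob_few_bad_vertices_tendsto_1) simp
  have "G \<in> ?cert n" if few_bad: "G \<in> regular_graphs n d" "?bad n G < sqrt n" for n G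
  proof -
    interpret regular_graph "{..<n}" d G using few_bad(1) by (simp add: regular_graphs_eq)
    have "(s + d * (\<gamma> / sqrt d)) * ?bad n G \<le> r * sqrt n"
      using few_bad(2) loss by (intro mult_mono) auto
    then show ?thesis
      using in_certified_graphs[OF d_gt_2 test]
      by (elim certified_graphs_mono[THEN subsetD, rotated]) simp
  qed
  then have "?prob n {G. ?bad n G < sqrt n} \<le> ?prob n (?cert n)" if "d < n" "even (d * n)" for n
    using set_pmf_of_set[OF regular_graphs_nonempty[OF that]]
      finite_Collect_regular_graph[of "{..<n}" d]
    by (intro measure_pmf.finite_measure_mono_AE) (auto simp: AE_measure_pmf_iff regular_graphs_eq)
  then show "\<forall>\<^sub>F n in feasible_sizes d. ?prob n {G. ?bad n G < sqrt n} \<le> ?prob n (?cert n)"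
    unfolding eventually_inf_principal by (intro eventually_sequentiallyI[of "Suc d"]) auto
qed simp_all

lemma relative_sqrt_loss:
  fixes \<rho> :: real
  assumes "0 < \<rho>"
  shows "(a - r / \<rho> / sqrt (real n)) * \<rho> * n = a * \<rho> * n - r * sqrt n"
proof -
  have "r / \<rho> / sqrt (real n) * \<rho> * n = r * (n / sqrt n)" using assms by simp
  then show ?thesis by (simp only: left_diff_distrib real_div_sqrt of_nat_0_le_iff)
qed

lemma ex_vanishing_loss_certified:
  assumes d: "3 \<le> d" and eps: "0 < \<epsilon>" and \<gamma>_pos: "0 < \<gamma>"
    and test: "test_polynomial d \<gamma> ((1 - 2 * \<epsilon>) * (2 * sqrt (real d - 1))) p"
  shows "\<exists>\<eta>. (\<eta> \<longlongrightarrow> 0) (feasible_sizes d) \<and>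
    ((\<lambda>n. measure_pmf.prob (random_regular_graph n d) (certified_graphs {..<n} \<gamma> (\<gamma> / sqrt d)
      ((1 - 2 * \<epsilon> - \<eta> n) * (2 * sqrt (real d - 1)) * n))) \<longlongrightarrow> 1) (feasible_sizes d)"
proof -
  define \<rho> r where "\<rho> = 2 * sqrt (real d - 1)" and "r = \<rho> + d * (\<gamma> / sqrt d)"
  have \<rho>_pos: "0 < \<rho>" and loss: "(1 - 2 * \<epsilon>) * \<rho> + d * (\<gamma> / sqrt d) \<le> r" "0 \<le> r"
    using d eps \<gamma>_pos by (simp_all add: \<rho>_def r_def)
  have "((\<lambda>n. r / \<rho> / sqrt (real n)) \<longlongrightarrow> 0) (feasible_sizes d)"
    by (rule tendsto_mono[OF inf_le1 const_over_sqrt_tendsto_0])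
  then show ?thesis
    using d prob_certified_graphs_tendsto_1[OF _ test[folded \<rho>_def] loss]
      relative_sqrt_loss[OF \<rho>_pos]
    unfolding \<rho>_def[symmetric] by (intro exI[of _ "\<lambda>n. r / \<rho> / sqrt (real n)"]) simp
qed

theorem theorem5p1:
  shows "\<forall>\<epsilon>::real. \<epsilon> > 0 \<longrightarrow>
    (\<exists>\<gamma> \<gamma>' \<gamma>'' :: real. \<gamma> > 0 \<and> \<gamma>' > 0 \<and> \<gamma>'' > 0 \<and>
      (\<forall>d::nat. d \<ge> 3 \<longrightarrow>
        (\<exists>\<eta> :: nat \<Rightarrow> real.
          (\<eta> \<longlongrightarrow> 0) (inf sequentially (principal {n. even (d * n)})) \<and>
          ((\<lambda>n. measure_pmf.prob (pmf_of_set (regular_graphs n d))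
              {G. \<exists>E. pseudoexpectation2 {..<n} E \<and>
                  E (quad_poly {..<n} (\<lambda>u v. - adj_matrix G u v))
                    \<ge> (1 - 2 * \<epsilon> - \<eta> n) * (2 * sqrt (real d - 1)) * real n \<and>
                  (\<forall>S\<in>small_subsets {..<n}.
                     L2_set (pseudomoment_matrix E S) (small_subsets {..<n}) \<le> \<gamma>) \<and>
                  spectral_norm (small_subsets {..<n}) (pseudomoment_matrix E) \<le> \<gamma>' \<and>
                  (\<forall>S\<in>small_subsets {..<n}. \<forall>T\<in>small_subsets {..<n}. S \<noteq> T \<longrightarrow>
                     \<bar>pseudomoment_matrix E S T\<bar> \<le> \<gamma>'' / sqrt (real d))})
            \<longlongrightarrow> 1) (inf sequentially (principal {n. even (d * n)})))))"
proof -
  have "\<exists>\<gamma>>0. \<forall>d\<ge>3. \<exists>\<eta>. (\<eta> \<longlongrightarrow> 0) (feasible_sizes d) \<and>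
      ((\<lambda>n. measure_pmf.prob (random_regular_graph n d) (certified_graphs {..<n} \<gamma> (\<gamma> / sqrt d)
        ((1 - 2 * \<epsilon> - \<eta> n) * (2 * sqrt (real d - 1)) * n))) \<longlongrightarrow> 1) (feasible_sizes d)"
    if "0 < \<epsilon>" for \<epsilon> :: real
  proof -
    obtain \<gamma> where "0 < \<gamma>"
      and "\<And>D. D > 2 \<Longrightarrow> \<exists>p. test_polynomial D \<gamma> ((1 - 2 * \<epsilon>) * (2 * sqrt (D - 1))) p"
      using ex_test_polynomial[OF \<open>0 < \<epsilon>\<close>] by blast
    moreover from this(2)
    have "\<exists>p. test_polynomial d \<gamma> ((1 - 2 * \<epsilon>) * (2 * sqrt (real d - 1))) p" if "3 \<le> d" for d :: nat
      using that by simp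
    ultimately show ?thesis
      using \<open>0 < \<epsilon>\<close> by (blast intro: ex_vanishing_loss_certified)
  qed
  then show ?thesis
    unfolding certified_graphs_def moment_bounded_def by blast
qed

end
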